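(* Let $\mathcal{I}$ be an o-minimal invariant that contains the orbit $\mathcal{O}(u)$ from some time $u\ge 0$, then there exists $t_0\ge u$ such that: \begin{align*} \mathcal{C}_{t_0}\subseteq \mathcal{I}. \end{align*}
   Context: A continuous linear dynamical system (CDS) is a pair $\langle A,\mathbf x_0\rangle$ with $A\in\mathbb Q^{d\times d}$, $\mathbf x_0\in\mathbb Q^d$, whose trajectory is $\mathbf x(t)=e^{At}\mathbf x_0$. The orbit from time $t_0$ is $\mathcal{O}(t_0)=\{e^{At}\mathbf x_0 : t\ge t_0\}$. An invariant from time $t_0$ is a set $\mathcal{I}\subseteq\mathbb R^d$ containing $e^{At_0}\mathbf x_0$ with $e^{At}\mathcal{I}\subseteq\mathcal{I}$ for all $t\ge 0$; an o-minimal invariant is one definable in an o-minimal expansion of the ordered real field with exponentiation. Write $A=PJP^{-1}$ in Jordan normal form, with eigenvalues $\lambda_l=\rho_l+\mathrm{i}\omega_l$, $l=1,\dots,k$, Jordan blocks $\Lambda_l+N_l$ ($N_l$ nilpotent), so that $e^{At}=P\,E(t)R(t)Q(t)\,P^{-1}$ with $E(t)=\mathrm{diag}(e^{\rho_1t},\dots,e^{\rho_kt})$, $R(t)=\mathrm{diag}(e^{\mathrm{i}\omega_1t},\dots,e^{\mathrm{i}\omega_kt})$ (entries repeated according to block sizes) and $Q(t)=\mathrm{diag}(e^{N_1t},\dots,e^{N_kt})$. Let $\mathbb{T}_\omega=\{\boldsymbol\tau\in\mathbb C^k: |\tau_i|=1,\ \tau_1^{a_1}\cdots\tau_k^{a_k}=1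 \text{ for all } \mathbf a\in\mathbb Z^k \text{ with } a_1\omega_1+\dots+a_k\omega_k=0\}$. The orbit cone from $t_0\ge0$ is $\mathcal{C}_{t_0}=\{P\,E(t)\,\mathrm{diag}(\boldsymbol\tau)\,Q(t)\,P^{-1}\mathbf x_0 : \boldsymbol\tau\in\mathbb{T}_\omega,\ t\ge t_0\}$. *)

theory Defs
  imports
    "HOL-Analysis.Analysis"
    "Jordan_Normal_Form.Jordan_Normal_Form"
begin

unbundle no vec_syntax


section \<open>Expansions of the ordered real field with exponentiation\<close>

text \<open>
  First-order formulas over the language of ordered rings with exponentiation, extended by
  arbitrary function symbols \<open>'f\<close> and relation symbols \<open>'r\<close>. Symbols carry no arity: a symbol
  applied to argument lists of different lengths plays the role of one symbol for each arity.
\<close>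

datatype 'f fo_term =
    Var nat
  | Zero
  | One
  | Add "'f fo_term" "'f fo_term"
  | Mult "'f fo_term" "'f fo_term"
  | Exp "'f fo_term"
  | Fn 'f "'f fo_term list"

datatype ('f, 'r) fo_formula =
    Equal "'f fo_term" "'f fo_term"
  | Less "'f fo_term" "'f fo_term"
  | Rel 'r "'f fo_term list"
  | Neg "('f, 'r) fo_formula"
  | Conj "('f, 'r) fo_formula" "('f, 'r) fo_formula"
  | Exists nat "('f, 'r) fo_formula"

text \<open>
  The universe and the basic symbols have a fixed meaning, so an expansion is determined by the
  interpretation of the additional symbols.
\<close>

record ('f, 'r) real_exp_expansion =
  fn_interp :: "'f \<Rightarrow> real list \<Rightarrow> real"
  rel_interp :: "'r \<Rightarrow> real list \<Rightarrow> bool"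

primrec term_val ::
    "('f, 'r) real_exp_expansion \<Rightarrow> (nat \<Rightarrow> real) \<Rightarrow> 'f fo_term \<Rightarrow> real" where
  "term_val M e (Var x) = e x"
| "term_val M e Zero = 0"
| "term_val M e One = 1"
| "term_val M e (Add s t) = term_val M e s + term_val M e t"
| "term_val M e (Mult s t) = term_val M e s * term_val M e t"
| "term_val M e (Exp t) = exp (term_val M e t)"
| "term_val M e (Fn f ts) = fn_interp M f (map (term_val M e) ts)"

primrec satisfies ::
    "('f, 'r) real_exp_expansion \<Rightarrow> (nat \<Rightarrow> real) \<Rightarrow> ('f, 'r) fo_formula \<Rightarrow> bool" where
  "satisfies M e (Equal s t) \<longleftrightarrow> term_val M e s = term_val M e t"
| "satisfies M e (Less s t) \<longleftrightarrow> term_val M e s < term_val M e t"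
| "satisfies M e (Rel r ts) \<longleftrightarrow> rel_interp M r (map (term_val M e) ts)"
| "satisfies M e (Neg p) \<longleftrightarrow> \<not> satisfies M e p"
| "satisfies M e (Conj p q) \<longleftrightarrow> satisfies M e p \<and> satisfies M e q"
| "satisfies M e (Exists x p) \<longleftrightarrow> (\<exists>a. satisfies M (e(x := a)) p)"

text \<open>
  Definability with real parameters: the variables below \<open>n\<close> range over the coordinates of the
  point, and the assignment \<open>e\<close> supplies the parameters as values of the other free variables.
\<close>

definition definable :: "('f, 'r) real_exp_expansion \<Rightarrow> nat \<Rightarrow> real vec set \<Rightarrow> bool" where
  "definable M n X \<longleftrightarrow>
    (\<exists>p e. X = {v \<in> carrier_vec n. satisfies M (\<lambda>i. if i < n then v $ i else e i) p})"

definition o_minimal :: "('f, 'r) real_exp_expansion \<Rightarrow> bool" where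
  "o_minimal M \<longleftrightarrow>
    (\<forall>X. definable M 1 X \<longrightarrow>
      (\<exists>F. finite F \<and> (\<forall>J\<in>F. is_interval J) \<and> (\<lambda>v. v $ 0) ` X = \<Union>F))"


section \<open>Continuous linear dynamical systems\<close>

text \<open>The exponential of a square matrix, with the power series summed entrywise.\<close>

definition mat_exp :: "'a::{real_normed_field, banach} mat \<Rightarrow> 'a mat" where
  "mat_exp A = Matrix.mat (dim_row A) (dim_row A) (\<lambda>(i, j). \<Sum>k. (A ^\<^sub>m k) $$ (i, j) / fact k)"

definition flow :: "rat mat \<Rightarrow> real \<Rightarrow> real mat" where
  "flow A t = mat_exp (t \<cdot>\<^sub>m map_mat real_of_rat A)"

definition trajectory :: "rat mat \<Rightarrow> rat vec \<Rightarrow> real \<Rightarrow> real vec" where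
  "trajectory A x0 t = flow A t *\<^sub>v map_vec real_of_rat x0"

definition orbit_from :: "rat mat \<Rightarrow> rat vec \<Rightarrow> real \<Rightarrow> real vec set" where
  "orbit_from A x0 t0 = {trajectory A x0 t | t. t \<ge> t0}"

definition invariant_from :: "rat mat \<Rightarrow> rat vec \<Rightarrow> real \<Rightarrow> real vec set \<Rightarrow> bool" where
  "invariant_from A x0 t0 I \<longleftrightarrow>
    I \<subseteq> carrier_vec (dim_row A) \<and> trajectory A x0 t0 \<in> I \<and>
    (\<forall>t\<ge>0. (\<lambda>v. flow A t *\<^sub>v v) ` I \<subseteq> I)"


section \<open>Orbit cones\<close>

text \<open>
  As in \<^const>\<open>jordan_matrix\<close>, a Jordan form is described by the list \<open>bs\<close> of its blocks
  (size, eigenvalue). Equal eigenvalues may occur in several blocks.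
\<close>

definition block_scalars :: "(nat \<times> complex) list \<Rightarrow> (nat \<Rightarrow> complex) \<Rightarrow> complex mat" where
  "block_scalars bs c = diag_block_mat (map (\<lambda>l. c l \<cdot>\<^sub>m 1\<^sub>m (fst (bs ! l))) [0..<length bs])"

definition E_mat :: "(nat \<times> complex) list \<Rightarrow> real \<Rightarrow> complex mat" where
  "E_mat bs t = block_scalars bs (\<lambda>l. complex_of_real (exp (Re (snd (bs ! l)) * t)))"

text \<open>The nilpotent part of a Jordan block of size \<open>n\<close> is \<open>jordan_block n 0\<close>.\<close>

definition Q_mat :: "(nat \<times> complex) list \<Rightarrow> real \<Rightarrow> complex mat" where
  "Q_mat bs t =
    diag_block_mat (map (\<lambda>(n, _). mat_exp (complex_of_real t \<cdot>\<^sub>m jordan_block n 0)) bs)"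

definition torus :: "real list \<Rightarrow> complex list set" where
  "torus ws = {z. length z = length ws \<and> (\<forall>i<length ws. cmod (z ! i) = 1) \<and>
    (\<forall>a :: nat \<Rightarrow> int. (\<Sum>i<length ws. of_int (a i) * ws ! i) = 0 \<longrightarrow>
      (\<Prod>i<length ws. (z ! i) powi a i) = 1)}"

text \<open>Here \<open>P'\<close> stands for the inverse of the transformation matrix \<open>P\<close>.\<close>

definition orbit_cone ::
    "(nat \<times> complex) list \<Rightarrow> complex mat \<Rightarrow> complex mat \<Rightarrow> rat vec \<Rightarrow> real \<Rightarrow> complex vec set" where
  "orbit_cone bs P P' x0 t0 =
    {(P * E_mat bs t * block_scalars bs (\<lambda>l. z ! l) * Q_mat bs t * P') *\<^sub>v map_vec of_rat x0 | z t.
      z \<in> torus (map (\<lambda>(_, a). Im a) bs) \<and> t \<ge> t0}"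

end

(*
  Let omega be the vector of imaginary parts of the eigenvalues. Choosing a Z-basis theta of the
  group generated by omega presents the torus T_omega as a monomial image of (S^1)^m, on which the
  rotation z -> (z_j e^(i theta_j s))_j has, by Kronecker's theorem, uniformly bounded return times
  to every open set. Write F(z, t) if the cone point with angle z at time t lies in I. Then F is
  definable in a rational chart of (S^1)^m, holds along the orbit, and is preserved by rotating by s
  while moving from t to t + s. By o-minimality every ray is eventually inside or
  eventually outside I; by Baire's theorem and the fact that a definable set contains or misses an
  open subset of every open set, there is an open set V of angles on which one of the two
  alternatives holds uniformly for all t >= n. The orbit returns to V at late times, so the rays
  over V are inside I, and flowing from V, which reaches every angle within bounded time, proves F(z, t)
  for all z and all t >= n + S.
*)

theory Submission
  imports Defs
begin

section \<open>Predicates and functions definable with parameters\<close>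

text \<open>The orbit itself is out of reach of o-minimality: if some frequency is nonzero,
  \<open>cis (\<omega> * t)\<close> oscillates as \<open>t\<close> grows and cannot be definable on
  a ray. Hence angle and time are decoupled. With the angle as a free variable, what remains in
  \<open>t\<close> is polynomial or exponential, which is where the exponential of the structure
  enters; the dynamics survives only as a rule linking an angle at \<open>t\<close> to the rotated
  angle at \<open>t + s\<close>. Since \<open>I\<close> is only forward invariant, this rule spreads
  membership in \<open>I\<close> but not non-membership along the flow. One \<open>t0\<close> for
  all angles needs two uniformities: a common threshold on an open set, and travel times bounded
  independently of the target. O-minimality speaks about subsets of the line only; in place of cell
  decomposition, countably many rational intervals and natural thresholds are combined with Baire's
  theorem in the complete space of all real sequences.\<close>

primrec rename_term :: "(nat \<Rightarrow> nat) \<Rightarrow> 'f fo_term \<Rightarrow> 'f fo_term" where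
  "rename_term f (Var x) = Var (f x)"
| "rename_term f Zero = Zero"
| "rename_term f One = One"
| "rename_term f (Add s t) = Add (rename_term f s) (rename_term f t)"
| "rename_term f (Mult s t) = Mult (rename_term f s) (rename_term f t)"
| "rename_term f (Exp t) = Exp (rename_term f t)"
| "rename_term f (Fn g ts) = Fn g (map (rename_term f) ts)"

primrec rename_formula :: "(nat \<Rightarrow> nat) \<Rightarrow> ('f, 'r) fo_formula \<Rightarrow> ('f, 'r) fo_formula" where
  "rename_formula f (Equal s t) = Equal (rename_term f s) (rename_term f t)"
| "rename_formula f (Less s t) = Less (rename_term f s) (rename_term f t)"
| "rename_formula f (Rel r ts) = Rel r (map (rename_term f) ts)"
| "rename_formula f (Neg p) = Neg (rename_formula f p)"
| "rename_formula f (Conj p q) = Conj (rename_formula f p) (rename_formula f q)"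
| "rename_formula f (Exists x p) = Exists (f x) (rename_formula f p)"

lemma term_val_rename: "term_val M e (rename_term f t) = term_val M (\<lambda>i. e (f i)) t"
  by (induction t) (auto simp: comp_def intro!: arg_cong[where f = "fn_interp M _"])

text \<open>Injectivity is what the quantifier needs: changing the value at \<open>f x\<close> must
  affect no other renamed variable.\<close>

lemma satisfies_rename:
  assumes "inj f"
  shows "satisfies M e (rename_formula f p) = satisfies M (\<lambda>i. e (f i)) p"
proof (induction p arbitrary: e)
  case (Rel r ts)
  then show ?case by (auto simp: comp_def term_val_rename)
next
  case (Exists x p)
  have "(\<lambda>i. (e(f x := a)) (f i)) = (\<lambda>i. e (f i))(x := a)" for a
    using assms by (auto simp: fun_eq_iff inj_eq)
  then show ?case using Exists by simp
qed (auto simp: term_val_rename)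

text \<open>
  Even variables of a formula hold the arguments and odd ones the parameters; renaming the odd
  variables injectively lets several formulas share one parameter assignment.
\<close>

definition mix :: "(nat \<Rightarrow> real) \<Rightarrow> (nat \<Rightarrow> real) \<Rightarrow> nat \<Rightarrow> real" where
  "mix v e i = (if even i then v (i div 2) else e (i div 2))"

lemma mix_even [simp]: "mix v e (2 * i) = v i" and mix_odd [simp]: "mix v e (Suc (2 * i)) = e i"
  by (auto simp: mix_def)

lemma mix_upd: "(mix v e)(2 * i := a) = mix (v(i := a)) e"
  by (auto simp: mix_def fun_eq_iff)

lemma even_odd_cases:
  fixes i :: nat
  obtains k where "i = 2 * k" | k where "i = Suc (2 * k)"
  by (metis evenE oddE Suc_eq_plus1)

text \<open>A semantic notion, so that closure properties replace the manipulation of formulas.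
  Assignments are infinite; a bound on the coordinates that matter is assumed separately where an
  induction runs over them.\<close>

definition definable_pred :: "('f, 'r) real_exp_expansion \<Rightarrow> ((nat \<Rightarrow> real) \<Rightarrow> bool) \<Rightarrow> bool" where
  "definable_pred M \<Phi> \<longleftrightarrow> (\<exists>p e. \<forall>v. \<Phi> v = satisfies M (mix v e) p)"

lemma definable_predI: "(\<And>v. \<Phi> v = satisfies M (mix v e) p) \<Longrightarrow> definable_pred M \<Phi>"
  unfolding definable_pred_def by blast

lemma definable_predE:
  assumes "definable_pred M \<Phi>"
  obtains p e where "\<And>v. \<Phi> v = satisfies M (mix v e) p"
  using assms unfolding definable_pred_def by blast

lemma definable_pred_neg: "definable_pred M \<Phi> \<Longrightarrow> definable_pred M (\<lambda>v. \<not> \<Phi> v)"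
  by (erule definable_predE, rule definable_predI[where p = "Neg _"], simp)

lemma definable_pred_conj:
  assumes "definable_pred M \<Phi>" "definable_pred M \<Psi>"
  shows "definable_pred M (\<lambda>v. \<Phi> v \<and> \<Psi> v)"
proof -
  obtain p e where p: "\<And>v. \<Phi> v = satisfies M (mix v e) p"
    using definable_predE[OF assms(1)] by metis
  obtain q e' where q: "\<And>v. \<Psi> v = satisfies M (mix v e') q"
    using definable_predE[OF assms(2)] by metis
  \<comment> \<open>\<open>f\<close> moves parameter \<open>k\<close> to slot \<open>2 * k\<close>
    of the joint assignment \<open>mix e e'\<close>, and \<open>g\<close> moves it to slot
    \<open>2 * k + 1\<close>; both fix the arguments.\<close>
  define f g where "f = (\<lambda>i::nat. if even i then i else 2 * i - 1)"
    and "g = (\<lambda>i::nat. if even i then i else 2 * i + 1)"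
  have "inj f" "inj g"
    unfolding f_def g_def by (rule injI, rename_tac x y, case_tac x rule: even_odd_cases;
      case_tac y rule: even_odd_cases; simp split: if_splits; presburger?)+
  moreover have "mix v (mix e e') (f i) = mix v e i" "mix v (mix e e') (g i) = mix v e' i" for v i
  proof -
    fix i
    show "mix v (mix e e') (f i) = mix v e i" "mix v (mix e e') (g i) = mix v e' i"
      by (cases i rule: even_odd_cases; simp add: f_def g_def mix_def)+
  qed
  ultimately have "(\<Phi> v \<and> \<Psi> v) = satisfies M (mix v (mix e e')) (Conj (rename_formula f p)
      (rename_formula g q))" for v
    by (simp add: satisfies_rename p q)
  then show ?thesis by (rule definable_predI)
qed

lemma definable_pred_ex_upd:
  assumes "definable_pred M \<Phi>"
  shows "definable_pred M (\<lambda>v. \<exists>a. \<Phi> (v(i := a)))"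
proof -
  obtain p e where p: "\<And>v. \<Phi> v = satisfies M (mix v e) p"
    using definable_predE[OF assms] by metis
  then have "(\<exists>a. \<Phi> (v(i := a))) = satisfies M (mix v e) (Exists (2 * i) p)" for v
    by (simp add: mix_upd)
  then show ?thesis by (rule definable_predI)
qed

lemma definable_pred_rename:
  assumes "definable_pred M \<Phi>" "inj f"
  shows "definable_pred M (\<lambda>v. \<Phi> (\<lambda>i. v (f i)))"
proof -
  obtain p e where p: "\<And>v. \<Phi> v = satisfies M (mix v e) p"
    using definable_predE[OF assms(1)] by metis
  define g where "g = (\<lambda>i. if even i then 2 * f (i div 2) else i)"
  have "inj g"
    unfolding g_def
  proof (rule injI)
    fix x y assume "(if even x then 2 * f (x div 2) else x) = (if even y then 2 * f (y div 2) else
      y)"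
    then show "x = y"
      by (cases x rule: even_odd_cases; cases y rule: even_odd_cases)
        (auto dest: injD[OF assms(2)], presburger+)
  qed
  moreover have "(\<lambda>i. mix v e (g i)) = mix (\<lambda>i. v (f i)) e" for v
    unfolding g_def fun_eq_iff by (auto simp: mix_def)
  ultimately have "\<Phi> (\<lambda>i. v (f i)) = satisfies M (mix v e) (rename_formula g p)" for v
    by (simp add: satisfies_rename p)
  then show ?thesis by (rule definable_predI)
qed

text \<open>In contrast to \<open>definable_pred_ex_upd\<close>, the bound value is pushed in front,
  in de Bruijn style, so that no coordinate has to be kept free for it.\<close>

lemma definable_pred_ex:
  assumes "definable_pred M \<Phi>"
  shows "definable_pred M (\<lambda>v. \<exists>a. \<Phi> (case_nat a v))"
proof -
  obtain p e where p: "\<And>v. \<Phi> v = satisfies M (mix v e) p"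
    using definable_predE[OF assms] by metis
  \<comment> \<open>Argument \<open>0\<close> becomes variable \<open>1\<close>, the slot of
    parameter \<open>0\<close>. To vacate it the parameters move up by one place; the other
    arguments move down by one.\<close>
  define f where "f = (\<lambda>i::nat. if i = 0 then 1 else if even i then i - 2 else i + 2)"
  have "inj f"
    unfolding f_def by (rule injI, rename_tac x y, case_tac x rule: even_odd_cases;
      case_tac y rule: even_odd_cases; simp split: if_splits; presburger?)
  moreover have "(\<lambda>i. ((mix v (case_nat 0 e))(1 := a)) (f i)) = mix (case_nat a v) e" for v a
  proof
    fix i :: nat
    consider "i = 0" | k where "i = 2 * Suc k" | k where "i = Suc (2 * k)"
      by (metis even_odd_cases nat.exhaust mult_0_right)
    then show "((mix v (case_nat 0 e))(1 := a)) (f i) = mix (case_nat a v) e i"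
      by cases (auto simp: f_def mix_def)
  qed
  ultimately have "(\<exists>a. \<Phi> (case_nat a v)) = satisfies M (mix v (case_nat 0 e)) (Exists 1
      (rename_formula f p))" for v
    by (simp add: satisfies_rename p)
  then show ?thesis by (rule definable_predI)
qed

lemma definable_pred_disj:
  assumes "definable_pred M \<Phi>" "definable_pred M \<Psi>"
  shows "definable_pred M (\<lambda>v. \<Phi> v \<or> \<Psi> v)"
proof -
  have "definable_pred M (\<lambda>v. \<not> (\<not> \<Phi> v \<and> \<not> \<Psi> v))"
    using assms by (intro definable_pred_neg definable_pred_conj)
  then show ?thesis by (simp only: de_Morgan_conj not_not)
qed

lemma definable_pred_imp:
  assumes "definable_pred M \<Phi>" "definable_pred M \<Psi>"
  shows "definable_pred M (\<lambda>v. \<Phi> v \<longrightarrow> \<Psi> v)"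
  unfolding imp_conv_disj using assms by (intro definable_pred_disj definable_pred_neg)

lemma definable_pred_all:
  assumes "definable_pred M \<Phi>"
  shows "definable_pred M (\<lambda>v. \<forall>a. \<Phi> (case_nat a v))"
  using definable_pred_neg[OF definable_pred_ex[OF definable_pred_neg[OF assms]]]
    by (simp only: not_ex not_not)

lemma definable_pred_all_upd:
  assumes "definable_pred M \<Phi>"
  shows "definable_pred M (\<lambda>v. \<forall>a. \<Phi> (v(i := a)))"
  using definable_pred_neg[OF definable_pred_ex_upd[OF definable_pred_neg[OF assms]]]
    by (simp only: not_ex not_not)

section \<open>Atomic predicates and definable functions\<close>

lemma definable_pred_atoms:
  shows "definable_pred M (\<lambda>v. v i = v j)" "definable_pred M (\<lambda>v. v i < v j)" "definable_pred M
    (\<lambda>v. v i = c)"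
    "definable_pred M (\<lambda>v. v i = v j + v k)" "definable_pred M (\<lambda>v. v i = v j * v k)"
      "definable_pred M (\<lambda>v. v i = exp (v j))"
proof -
  have [simp]: "mix v e (Suc 0) = e 0" for v e :: "nat \<Rightarrow> real"
    using mix_odd[of v e 0] by simp
  show "definable_pred M (\<lambda>v. v i = v j)"
    by (rule definable_predI[where p = "Equal (Var (2 * i)) (Var (2 * j))"]) simp
  show "definable_pred M (\<lambda>v. v i < v j)"
    by (rule definable_predI[where p = "Less (Var (2 * i)) (Var (2 * j))"]) simp
  show "definable_pred M (\<lambda>v. v i = c)"
    by (rule definable_predI[where p = "Equal (Var (2 * i)) (Var 1)" and e = "\<lambda>_. c"]) simp
  show "definable_pred M (\<lambda>v. v i = v j + v k)"
    by (rule definable_predI[where p = "Equal (Var (2 * i)) (Add (Var (2 * j)) (Var (2 * k)))"])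
      simp
  show "definable_pred M (\<lambda>v. v i = v j * v k)"
    by (rule definable_predI[where p = "Equal (Var (2 * i)) (Mult (Var (2 * j)) (Var (2 * k)))"])
      simp
  show "definable_pred M (\<lambda>v. v i = exp (v j))"
    by (rule definable_predI[where p = "Equal (Var (2 * i)) (Exp (Var (2 * j)))"]) simp
qed

text \<open>In the graph of a function, variable \<open>0\<close> is the value and the arguments are shifted by one.\<close>

definition definable_fun :: "('f, 'r) real_exp_expansion \<Rightarrow> ((nat \<Rightarrow> real) \<Rightarrow> real) \<Rightarrow> bool" where
  "definable_fun M g \<longleftrightarrow> definable_pred M (\<lambda>w. w 0 = g (\<lambda>i. w (Suc i)))"

lemma definable_fun_rename:
  assumes "definable_fun M g" "inj f"
  shows "definable_fun M (\<lambda>v. g (\<lambda>i. v (f i)))"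
proof -
  have "inj (case_nat 0 (\<lambda>i. Suc (f i)))"
    by (rule injI) (simp add: inj_eq[OF assms(2)] split: nat.splits)
  from definable_pred_rename[OF assms(1)[unfolded definable_fun_def] this] show ?thesis
    by (simp add: definable_fun_def)
qed

text \<open>\<open>g\<close> need not be given by a term, so its value is introduced by a quantifier
  and pinned down by the graph of \<open>g\<close>.\<close>

lemma definable_pred_subst:
  assumes "definable_pred M \<Phi>" "definable_fun M g"
  shows "definable_pred M (\<lambda>v. \<Phi> (case_nat (g v) v))"
proof -
  have "definable_pred M (\<lambda>v. \<exists>a. (\<lambda>w. w 0 = g (\<lambda>i. w (Suc i)) \<and> \<Phi> w) (case_nat a v))"
    using assms unfolding definable_fun_def by (intro definable_pred_ex definable_pred_conj)
  then show ?thesis by simp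
qed

lemma definable_pred_subst2:
  assumes "definable_pred M \<Phi>" "definable_fun M g" "definable_fun M h"
  shows "definable_pred M (\<lambda>v. \<Phi> (case_nat (g v) (case_nat (h v) v)))"
  using definable_pred_subst[OF definable_pred_subst[OF assms(1) definable_fun_rename[OF assms(2),
    of Suc]] assms(3)] by simp

lemma definable_pred_less: "definable_fun M g \<Longrightarrow> definable_fun M h
    \<Longrightarrow> definable_pred M (\<lambda>v. g v < h v)"
  using definable_pred_subst2[OF definable_pred_atoms(2)[of M 0 1], of g h] by simp

lemma definable_pred_eq: "definable_fun M g \<Longrightarrow> definable_fun M h \<Longrightarrow> definable_pred M (\<lambda>v. g v = h v)"
  using definable_pred_subst2[OF definable_pred_atoms(1)[of M 0 1], of g h] by simp

lemma definable_pred_le: "definable_fun M g \<Longrightarrow> definable_fun M h \<Longrightarrow> definable_pred M (\<lambda>v. g v \<le> h v)"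
  using definable_pred_neg[OF definable_pred_less[of M h g]] by (simp add: not_less)

text \<open>The value of the composite is coordinate \<open>0\<close> of its graph and moves to
  coordinate \<open>2\<close> once the values of \<open>g\<close> and \<open>h\<close> are pushed in
  front.\<close>

lemma definable_fun_comp2:
  assumes "definable_pred M (\<lambda>v. v 2 = op (v 0) (v 1))" "definable_fun M g" "definable_fun M h"
  shows "definable_fun M (\<lambda>v. op (g v) (h v))"
  using definable_pred_subst2[OF assms(1) definable_fun_rename[OF assms(2), of Suc]
    definable_fun_rename[OF assms(3), of Suc]]
  by (simp add: definable_fun_def numeral_2_eq_2)

lemma definable_fun_add: "definable_fun M g \<Longrightarrow> definable_fun M h \<Longrightarrow> definable_fun M (\<lambda>v. g v + h v)"
  by (rule definable_fun_comp2[where op = "(+)", OF definable_pred_atoms(4)])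

lemma definable_fun_mult: "definable_fun M g \<Longrightarrow> definable_fun M h \<Longrightarrow> definable_fun M (\<lambda>v. g v * h v)"
  by (rule definable_fun_comp2[where op = "(*)", OF definable_pred_atoms(5)])

lemma definable_fun_exp: "definable_fun M g \<Longrightarrow> definable_fun M (\<lambda>v. exp (g v))"
  by (rule definable_fun_comp2[where op = "\<lambda>a b. exp a"
    and h = g]) (auto intro: definable_pred_atoms)

lemma definable_fun_const [simp]: "definable_fun M (\<lambda>v. c)"
  unfolding definable_fun_def by (rule definable_pred_atoms)

lemma definable_fun_var [simp]: "definable_fun M (\<lambda>v. v i)"
  unfolding definable_fun_def by (rule definable_pred_atoms)

lemma definable_fun_uminus: "definable_fun M g \<Longrightarrow> definable_fun M (\<lambda>v. - g v)"
  using definable_fun_mult[OF definable_fun_const[of M "-1"], of g] by simp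

lemma definable_fun_diff: "definable_fun M g \<Longrightarrow> definable_fun M h \<Longrightarrow> definable_fun M (\<lambda>v. g v - h v)"
  using definable_fun_add[OF _ definable_fun_uminus, of M g h] by simp

lemma definable_fun_inverse:
  assumes "definable_fun M g"
  shows "definable_fun M (\<lambda>v. inverse (g v))"
proof (rule definable_fun_comp2[where op = "\<lambda>a b. inverse a" and h = g, OF _ assms assms])
  \<comment> \<open>The convention \<open>inverse 0 = 0\<close> has to be described as a case of its
    own.\<close>
  have "(y = inverse x) = ((x = 0 \<and> y = 0) \<or> x * y = 1)" for x y :: real
    by (cases "x = 0") (auto simp: inverse_unique)
  moreover have "definable_pred M (\<lambda>v. (v 0 = 0 \<and> v 2 = 0) \<or> v 0 * v 2 = 1)"
    by (intro definable_pred_disj definable_pred_conj definable_pred_eq definable_fun_mult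
      definable_fun_var definable_fun_const)
  ultimately show "definable_pred M (\<lambda>v. v 2 = inverse (v 0))" by simp
qed

lemma definable_fun_divide: "definable_fun M g \<Longrightarrow> definable_fun M h
    \<Longrightarrow> definable_fun M (\<lambda>v. g v / h v)"
  using definable_fun_mult[OF _ definable_fun_inverse, of M g h] by (simp add: divide_inverse)

lemma definable_pred_True: "definable_pred M (\<lambda>v. True)"
  using definable_pred_atoms(1)[of M 0 0] by simp

lemma definable_pred_Ball_less:
  assumes "\<And>i. i < n \<Longrightarrow> definable_pred M (\<Phi> i)"
  shows "definable_pred M (\<lambda>v. \<forall>i<n::nat. \<Phi> i v)"
  using assms
proof (induction n)
  case (Suc n)
  have "definable_pred M (\<lambda>v. (\<forall>i<n. \<Phi> i v) \<and> \<Phi> n v)"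
    by (rule definable_pred_conj) (use Suc in simp_all)
  then show ?case by (simp only: All_less_Suc conj_commute)
qed (simp add: definable_pred_True)

lemma definable_pred_subst_block:
  assumes "definable_pred M \<Phi>" "\<And>i. i < k \<Longrightarrow> definable_fun M (g i)"
  shows "definable_pred M (\<lambda>v. \<Phi> (\<lambda>i. if i < k then g i v else v (i - k)))"
  using assms
proof (induction k arbitrary: \<Phi> g)
  case (Suc k)
  \<comment> \<open>The value of \<open>g k\<close> will stand directly in front of the old
    assignment, so the functions before it must skip one coordinate.\<close>
  have "definable_pred M (\<lambda>w. \<Phi> (\<lambda>i. if i < k then g i (\<lambda>j. w (Suc j)) else w (i - k)))"
    by (rule Suc.IH[OF Suc.prems(1), of "\<lambda>i w. g i (\<lambda>j. w (Suc j))"])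
      (rule definable_fun_rename[of _ _ Suc], use Suc.prems(2) in simp_all)
  from definable_pred_subst[OF this Suc.prems(2)[of k]]
  have "definable_pred M (\<lambda>v. \<Phi> (\<lambda>i. if i < k then g i v else (case_nat (g k v) v) (i - k)))"
    by (simp only: nat.case)
  moreover have "(if i < k then g i v else (case_nat (g k v) v) (i - k)) =
      (if i < Suc k then g i v else v (i - Suc k))" for v i
  proof -
    consider "i < k" | "i = k" | j where "i = Suc (k + j)"
      using less_imp_Suc_add[of k i] by (cases i k rule: linorder_cases) auto
    then show ?thesis
      by cases (auto simp: Suc_diff_le)
  qed
  ultimately show ?case by (simp only:)
qed simp

section \<open>Definable sets and their one-dimensional fibres\<close>

lemma definable_pred_vec:
  assumes "definable M n X"
  shows "definable_pred M (\<lambda>v. Matrix.vec n v \<in> X)"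
proof -
  obtain p e where X: "X = {v \<in> carrier_vec n. satisfies M (\<lambda>i. if i < n then v $ i else e i) p}"
    using assms unfolding definable_def by blast
  \<comment> \<open>The first \<open>n\<close> variables are coordinates of the point and become
    arguments; the others were filled by \<open>e\<close> and go to the parameter slots of the same
    index.\<close>
  define f where "f = (\<lambda>i. if i < n then 2 * i else Suc (2 * i))"
  have "inj f"
    unfolding f_def by (rule injI, rename_tac x y, case_tac x rule: even_odd_cases;
      case_tac y rule: even_odd_cases; simp split: if_splits; presburger?)
  moreover have "(\<lambda>i. mix v e (f i)) = (\<lambda>i. if i < n then Matrix.vec n v $ i else e i)" for v
    unfolding f_def by auto
  ultimately have "(Matrix.vec n v \<in> X) = satisfies M (mix v e) (rename_formula f p)" for v
    by (simp add: satisfies_rename X)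
  then show ?thesis by (rule definable_predI)
qed

text \<open>All coordinates but the \<open>i\<close>th can be passed as parameters, which turns
  o-minimality into a statement about every line parallel to an axis.\<close>

lemma o_minimal_definable_pred:
  assumes "o_minimal M" "definable_pred M \<Phi>"
  shows "\<exists>F. finite F \<and> (\<forall>J\<in>F. is_interval J) \<and> {a. \<Phi> (v(i := a))} = \<Union>F"
proof -
  obtain p e where p: "\<And>v. \<Phi> v = satisfies M (mix v e) p"
    using definable_predE[OF assms(2)] by metis
  \<comment> \<open>\<open>definable M 1\<close> reads its point from variable \<open>0\<close>,
    which therefore trades places with variable \<open>2 * i\<close>; the rest of the exchanged
    assignment supplies the parameters.\<close>
  define f where "f = Transposition.transpose 0 (2 * i)"
  have f: "inj f" "f 0 = 2 * i" "f (f k) = k" for k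
    unfolding f_def by simp_all
  define W where "W = (\<lambda>k. mix v e (f k))"
  have "(\<lambda>k. (W(0 := a)) (f k)) = (mix v e)(2 * i := a)" for a
  proof
    fix k
    have "f k = 0 \<longleftrightarrow> k = 2 * i"
      using f(3)[of k] f(3)[of 0] f(2) by (auto simp: Transposition.transpose_def f_def)
    then show "(W(0 := a)) (f k) = ((mix v e)(2 * i := a)) k"
      using f(3)[of k] by (simp add: W_def)
  qed
  then have *: "\<Phi> (v(i := a)) = satisfies M (W(0 := a)) (rename_formula f p)" for a
    using f by (simp add: satisfies_rename p mix_upd)
  define X where "X = {x \<in> carrier_vec 1. satisfies M (\<lambda>k. if k < 1 then x $ k else W k)
      (rename_formula f p)}"
  have "definable M 1 X"
    unfolding definable_def X_def by (intro exI, rule refl)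
  then have "\<exists>F. finite F \<and> (\<forall>J\<in>F. is_interval J) \<and> (\<lambda>x. x $ 0) ` X = \<Union>F"
    using assms(1) unfolding o_minimal_def by blast
  moreover have "(\<lambda>x. x $ 0) ` X = {a. \<Phi> (v(i := a))}"
  proof (intro equalityI subsetI)
    fix a assume "a \<in> {a. \<Phi> (v(i := a))}"
    moreover have "(\<lambda>k. if k < 1 then Matrix.vec 1 (\<lambda>_. a) $ k else W k) = W(0 := a)"
      by auto
    ultimately have "Matrix.vec 1 (\<lambda>_. a) \<in> X"
      unfolding X_def mem_Collect_eq * by simp
    then show "a \<in> (\<lambda>x. x $ 0) ` X"
      by (rule rev_image_eqI) simp
  next
    fix a assume "a \<in> (\<lambda>x. x $ 0) ` X"
    then obtain x where x: "satisfies M (\<lambda>k. if k < 1 then x $ k else W k) (rename_formula f p)"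
        "a = x $ 0"
      unfolding X_def by auto
    moreover have "(\<lambda>k. if k < 1 then x $ k else W k) = W(0 := x $ 0)"
      by auto
    ultimately show "a \<in> {a. \<Phi> (v(i := a))}"
      by (simp add: *)
  qed
  ultimately show ?thesis by simp
qed

section \<open>Generic behaviour of definable predicates\<close>

text \<open>Either some member has two points in \<open>(a, b)\<close> and fills the gap between
  them, or each has at most one and the union is finite there. Rational endpoints leave only
  countably many cases, as Baire's theorem requires.\<close>

lemma interval_union_cases:
  fixes a b :: real and F :: "real set set"
  assumes "finite F" "\<And>J. J \<in> F \<Longrightarrow> is_interval J" "a < b"
  shows "\<exists>p q :: rat. a < of_rat p \<and> p < q \<and> of_rat q < b \<and>
    ({of_rat p<..<of_rat q} \<subseteq> \<Union>F \<or> {of_rat p<..<of_rat q} \<inter> \<Union>F = {})"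
proof -
  have "\<exists>x y. a \<le> x \<and> x < y \<and> y \<le> b \<and> ({x<..<y} \<subseteq> \<Union>F \<or> {x<..<y} \<inter> \<Union>F = {})"
  proof (cases "\<exists>J\<in>F. \<exists>x\<in>J. \<exists>y\<in>J. a < x \<and> x < y \<and> y < b")
    case True
    then obtain J x y where J: "J \<in> F" "x \<in> J" "y \<in> J" "a < x" "x < y" "y < b" by blast
    have "z \<in> J" if "z \<in> {x<..<y}" for z
      using assms(2)[OF J(1)] J(2,3) that less_imp_le unfolding is_interval_1
        greaterThanLessThan_iff
      by blast
    then have "{x<..<y} \<subseteq> J" by blast
    then have "{x<..<y} \<subseteq> \<Union>F" using J(1) by blast
    then show ?thesis using J less_imp_le by blast
  next
    case False
    have "finite ({a<..<b} \<inter> J)" if "J \<in> F" for J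
    proof (cases "{a<..<b} \<inter> J = {}")
      case nonempty: False
      then obtain x where x: "x \<in> {a<..<b} \<inter> J" by blast
      have "y = x" if "y \<in> {a<..<b} \<inter> J" for y
      proof (rule ccontr)
        assume "y \<noteq> x"
        then consider "x < y" | "y < x" by linarith
        then show False
          using False \<open>J \<in> F\<close> x \<open>y \<in> {a<..<b} \<inter> J\<close> by cases auto
      qed
      then have "{a<..<b} \<inter> J \<subseteq> {x}" by blast
      then show ?thesis using finite_subset by blast
    qed simp
    then have fin: "finite ({a<..<b} \<inter> \<Union>F)"
      unfolding Int_Union by (rule finite_UN_I[OF assms(1)])
    then have "open ({a<..<b} - ({a<..<b} \<inter> \<Union>F))"
      by (intro open_Diff finite_imp_closed) auto
    moreover have "{a<..<b} - ({a<..<b} \<inter> \<Union>F) \<noteq> {}"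
      using finite_subset[OF _ fin, of "{a<..<b}"] infinite_Ioo[OF assms(3)] by blast
    then obtain c where "c \<in> {a<..<b} - ({a<..<b} \<inter> \<Union>F)" by blast
    ultimately obtain e where e: "e > 0" "ball c e \<subseteq> {a<..<b} - ({a<..<b} \<inter> \<Union>F)"
      using open_contains_ball by blast
    then have "c \<in> {a<..<b}" "{c<..<c+e} \<subseteq> {a<..<b} - ({a<..<b} \<inter> \<Union>F)"
      by (auto simp: subset_iff dist_real_def)
    then have "{c<..<min b (c+e)} \<inter> \<Union>F = {}" "a \<le> c" "c < min b (c + e)"
      using e by auto
    then show ?thesis by (intro exI[of _ c] exI[of _ "min b (c + e)"]) auto
  qed
  then obtain x y where xy: "a \<le> x" "x < y" "y \<le> b" "{x<..<y} \<subseteq> \<Union>F \<or> {x<..<y} \<inter> \<Union>F = {}"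
    by blast
  obtain p where p: "x < of_rat p" "of_rat p < y" using of_rat_dense[OF xy(2)] by blast
  obtain q where q: "of_rat p < (of_rat q :: real)" "of_rat q < y"
      using of_rat_dense[OF p(2)] by blast
  have "{of_rat p<..<of_rat q} \<subseteq> {x<..<y}" using p q by auto
  with xy(4) have "{of_rat p<..<of_rat q} \<subseteq> \<Union>F \<or> {of_rat p<..<of_rat q} \<inter> \<Union>F = {}" by blast
  moreover have "p < q" using q by (simp add: of_rat_less)
  ultimately show ?thesis using p q xy(1,3) by (intro exI[of _ p] exI[of _ q]) auto
qed

text \<open>An interval unbounded above contains a ray; if there is none, the finite union is
  bounded above. Natural thresholds again keep the cases countable.\<close>

lemma interval_union_eventually:
  fixes F :: "real set set"
  assumes "finite F" "\<And>J. J \<in> F \<Longrightarrow> is_interval J"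
  shows "(\<exists>n::nat. \<forall>t\<ge>real n. t \<in> \<Union>F) \<or> (\<exists>n::nat. \<forall>t\<ge>real n. t \<notin> \<Union>F)"
proof (cases "\<forall>J\<in>F. bdd_above J")
  case True
  then have "bdd_above (\<Union>J\<in>F. J)"
    using assms(1) by (subst bdd_above_UN) auto
  then obtain B where B: "\<And>t. t \<in> \<Union>F \<Longrightarrow> t \<le> B"
    unfolding bdd_above_def by auto
  obtain n :: nat where "B < real n" using reals_Archimedean2 by blast
  then have "\<forall>t\<ge>real n. t \<notin> \<Union>F" using B by fastforce
  then show ?thesis by blast
next
  case False
  then obtain J where J: "J \<in> F" "\<not> bdd_above J" by auto
  then have "J \<noteq> {}" by auto
  then obtain x where x: "x \<in> J" by blast
  have "t \<in> J" if "x \<le> t" for t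
  proof -
    obtain y where "y \<in> J" "t < y"
      using J(2) unfolding bdd_above_def by (meson not_le)
    then show ?thesis
      using assms(2)[OF J(1)] x that unfolding is_interval_1 by (meson less_imp_le)
  qed
  moreover obtain n :: nat where n: "x < real n" using reals_Archimedean2 by blast
  ultimately have "t \<in> \<Union>F" if "t \<ge> real n" for t
    using J(1) that by (intro UnionI[of J]) auto
  then show ?thesis by blast
qed

section \<open>From dense to open sets by Baire category\<close>

text \<open>Baire's theorem relative to \<open>U\<close>. Cutting the closures down to
  \<open>closure U\<close> discards their behaviour away from \<open>U\<close>, where members of the
  cover may well have interior.\<close>

lemma Baire_somewhere_dense:
  fixes U :: "'a::complete_space set"
  assumes "countable \<A>" "open U" "U \<noteq> {}" "U \<subseteq> \<Union>\<A>"
  obtains A V where "A \<in> \<A>" "open V" "V \<noteq> {}" "V \<subseteq> U" "V \<subseteq> closure A"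
proof (rule ccontr)
  note found = that
  assume none: "\<not> thesis"
  have int: "interior (closure A \<inter> closure U) = {}" if that_A: "A \<in> \<A>" for A
  proof -
    have "U \<inter> interior (closure A) = {}"
      proof (rule ccontr)
      assume "U \<inter> interior (closure A) \<noteq> {}"
      with that_A show False
        using none found[of A "U \<inter> interior (closure A)"] assms(2) interior_subset by blast
    qed
    then have "closure U \<inter> interior (closure A) = {}"
      using open_Int_closure_eq_empty[OF open_interior, of "closure A" U] by blast
    then show ?thesis
      using interior_subset[of "closure U"] by auto
  qed
  have "euclidean interior_of \<Union>((\<lambda>A. closure A \<inter> closure U) ` \<A>) = {}"
    by (rule Baire_category_alt)
      (use assms(1) in \<open>auto simp: completely_metrizable_space_euclidean int
        simp del: interior_Int\<close>)
  then have "interior (\<Union>((\<lambda>A. closure A \<inter> closure U) ` \<A>)) = {}"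
    by simp
  moreover have "U \<subseteq> \<Union>((\<lambda>A. closure A \<inter> closure U) ` \<A>)"
  proof
    fix x assume "x \<in> U"
    then obtain A where "A \<in> \<A>" "x \<in> A" using assms(4) by blast
    then show "x \<in> \<Union>((\<lambda>A. closure A \<inter> closure U) ` \<A>)"
      using \<open>x \<in> U\<close> by (intro UN_I[of A]) (auto intro: subsetD[OF closure_subset])
  qed
  ultimately show False
    using interior_maximal[OF _ assms(2)] assms(3) by blast
qed

lemma continuous_on_fun_upd:
  "continuous_on S (\<lambda>(w, a). (w(N := a)) :: 'a \<Rightarrow> 'b::topological_space)"
  unfolding case_prod_unfold
proof (rule continuous_on_coordinatewise_then_product)
  fix i
  have "continuous_on S (\<lambda>x. fst x i)"
    using continuous_on_product_then_coordinatewise[OF continuous_on_fst[OF continuous_on_id]] .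
  moreover have "continuous_on S snd" by (intro continuous_intros)
  ultimately show "continuous_on S (\<lambda>x. ((fst x)(N := snd x)) i)"
    by (cases "i = N") auto
qed

text \<open>
  For each choice of the first \<open>N\<close> coordinates, o-minimality makes \<open>\<Phi>\<close> constant on some rational
  interval of the last one. By Baire, a single interval and truth value work on a somewhere dense set, which
  is definable and depends on fewer coordinates.
\<close>

lemma definable_pred_somewhere_constant:
  assumes "o_minimal M" "definable_pred M \<Phi>" "\<And>v w. (\<And>i. i < N \<Longrightarrow> v i = w i) \<Longrightarrow> \<Phi> v = \<Phi> w"
    and "open U" "U \<noteq> {}"
  obtains V where "open V" "V \<noteq> {}" "V \<subseteq> U" "(\<forall>v\<in>V. \<Phi> v) \<or> (\<forall>v\<in>V. \<not> \<Phi> v)"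
  using assms(2-)
proof (induction N arbitrary: \<Phi> U thesis)
  case 0
  then have "(\<forall>v\<in>U. \<Phi> v) \<or> (\<forall>v\<in>U. \<not> \<Phi> v)" by blast
  then show ?case using 0 by blast
next
  case (Suc N)
  have cont: "continuous_on UNIV (\<lambda>(w, a). (w(N := a)) :: nat \<Rightarrow> real)"
    by (rule continuous_on_fun_upd)
  obtain v0 where v0: "v0 \<in> U" using Suc.prems by blast
  have "open ((\<lambda>(w, a). w(N := a)) -` U)"
    using open_vimage[OF \<open>open U\<close> cont] .
  moreover have "(v0, v0 N) \<in> (\<lambda>(w, a). w(N := a)) -` U" using v0 by simp
  ultimately obtain A B where AB: "open A" "open B" "v0 \<in> A" "v0 N \<in> B"
      "A \<times> B \<subseteq> (\<lambda>(w, a). w(N := a)) -` U"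
    by (rule open_prod_elim) (auto)
  obtain e where e: "e > 0" "ball (v0 N) e \<subseteq> B" using AB open_contains_ball by blast
  define R :: "(rat \<times> rat) set" where
    "R = {(p, q). p < q \<and> {of_rat p<..<of_rat q} \<subseteq> B}"
  define X where "X = (\<lambda>\<sigma> (p, q). {v. \<forall>a. of_rat p < a \<longrightarrow> a < of_rat q \<longrightarrow> \<Phi> (v(N := a)) = \<sigma>})"
  have "v \<in> \<Union>((\<lambda>(\<sigma>, r). X \<sigma> r) ` (UNIV \<times> R))" for v
  proof -
    obtain F where F: "finite F" "\<forall>J\<in>F. is_interval J" "{a. \<Phi> (v(N := a))} = \<Union>F"
      using o_minimal_definable_pred[OF assms(1) \<open>definable_pred M \<Phi>\<close>] by metis
    obtain p q :: rat where pq: "v0 N - e < of_rat p" "p < q" "of_rat q < v0 N + e"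
      "{of_rat p<..<of_rat q} \<subseteq> \<Union>F \<or> {of_rat p<..<of_rat q} \<inter> \<Union>F = {}"
      using interval_union_cases[of F "v0 N - e" "v0 N + e"] F \<open>e > 0\<close> by auto
    then have "{of_rat p<..<of_rat q} \<subseteq> ball (v0 N) e"
      by (auto simp: dist_real_def)
    then have "(p, q) \<in> R" using e pq unfolding R_def by blast
    moreover have "v \<in> X True (p, q) \<or> v \<in> X False (p, q)"
      using pq(4) unfolding F(3)[symmetric] X_def by auto
    ultimately show ?thesis by blast
  qed
  then have "A \<subseteq> \<Union>((\<lambda>(\<sigma>, r). X \<sigma> r) ` (UNIV \<times> R))" by blast
  then obtain C V1 where C: "C \<in> (\<lambda>(\<sigma>, r). X \<sigma> r) ` (UNIV \<times> R)"
      and V1: "open V1" "V1 \<noteq> {}" "V1 \<subseteq> A" "V1 \<subseteq> closure C"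
    using Baire_somewhere_dense[of _ A] \<open>open A\<close> \<open>v0 \<in> A\<close>
      by (metis countable_image countableI_type empty_iff)
  obtain \<sigma> p q where C: "C = X \<sigma> (p, q)" and pq: "(p, q) \<in> R" using C by auto
  \<comment> \<open>Writing \<open>(v(N := a)) N\<close> for \<open>a\<close> gives the quantified
    predicate the form that \<open>definable_pred_all_upd\<close> handles.\<close>
  define \<Psi> where "\<Psi> = (\<lambda>v. \<forall>a. (of_rat p < (v(N := a)) N \<and> (v(N := a)) N < of_rat q)
      \<longrightarrow> (\<Phi> (v(N := a)) = \<sigma>))"
  have "definable_pred M (\<lambda>v. \<Phi> v = \<sigma>)"
    using Suc.prems(2) definable_pred_neg[OF Suc.prems(2)] by (cases \<sigma>) auto
  then have "definable_pred M \<Psi>"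
    unfolding \<Psi>_def by (intro definable_pred_all_upd[where \<Phi> = "\<lambda>v. of_rat p < v N \<and> v N < of_rat
      q \<longrightarrow> \<Phi> v = \<sigma>"]
       definable_pred_imp definable_pred_conj definable_pred_less definable_fun_var
         definable_fun_const)
  moreover have "\<Psi> v = \<Psi> w" if "\<And>i. i < N \<Longrightarrow> v i = w i" for v w
  proof -
    have "\<Phi> (v(N := a)) = \<Phi> (w(N := a))" for a
      using that by (intro Suc.prems(3)) auto
    then show ?thesis unfolding \<Psi>_def by simp
  qed
  ultimately obtain V2 where V2: "open V2" "V2 \<noteq> {}" "V2 \<subseteq> V1" "(\<forall>v\<in>V2. \<Psi> v) \<or> (\<forall>v\<in>V2. \<not> \<Psi> v)"
    using Suc.IH[where \<Phi> = \<Psi> and U = V1] V1 by metis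
  have C\<Psi>: "C = Collect \<Psi>" unfolding C X_def \<Psi>_def by auto
  \<comment> \<open>\<open>\<Psi>\<close> is constant on \<open>V2\<close>; a single point of
    \<open>C\<close> there decides that the constant value is true.\<close>
  have "V2 \<inter> C \<noteq> {}"
    using V1 V2 open_Int_closure_eq_empty[of V2 C] by blast
  then have \<Psi>: "\<Psi> v" if "v \<in> V2" for v using V2 that unfolding C\<Psi> by blast
  obtain v2 where v2: "v2 \<in> V2" using V2 by blast
  \<comment> \<open>\<open>\<Psi>\<close> ignores coordinate \<open>N\<close>. Resetting it to
    \<open>v2 N\<close> tests the other coordinates, while its actual value may range over the
    rational interval.\<close>
  define V where "V = {w. w(N := v2 N) \<in> V2} \<inter> {w. of_rat p < w N} \<inter> {w. w N < of_rat q}"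
  have "continuous_on UNIV (\<lambda>w :: nat \<Rightarrow> real. w(N := v2 N))"
    using continuous_on_compose2[OF cont, of UNIV "\<lambda>w. (w, v2 N)"]
    by (simp add: continuous_on_Pair continuous_on_id del: fun_upd_apply)
  from open_vimage[OF \<open>open V2\<close> this] have "open V"
    unfolding V_def by (intro open_Int open_Collect_less) (auto simp: vimage_def)
  moreover have "V \<noteq> {}"
  proof -
    have "of_rat p < (of_rat q :: real)" using pq by (simp add: R_def of_rat_less)
    then obtain c :: real where "of_rat p < c" "c < of_rat q" using dense by blast
    then have "v2(N := c) \<in> V" using v2 by (simp add: V_def)
    then show ?thesis by blast
  qed
  moreover have "w \<in> U \<and> \<Phi> w = \<sigma>" if "w \<in> V" for w
  proof
    have w: "w(N := v2 N) \<in> V2" "of_rat p < w N" "w N < of_rat q" using that by (auto simp: V_def)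
    then have "w N \<in> B" using pq by (auto simp: R_def)
    moreover have "w(N := v2 N) \<in> A" using w V2 V1 by blast
    ultimately have "(w(N := v2 N), w N) \<in> (\<lambda>(w, a). w(N := a)) -` U" using AB by blast
    then show "w \<in> U" by simp
    show "\<Phi> w = \<sigma>"
      using \<Psi>[OF w(1)] w(2,3) unfolding \<Psi>_def by (auto dest: spec[of _ "w N"])
  qed
  ultimately show ?case using Suc.prems(1)[of V] by (cases \<sigma>) blast+
qed

text \<open>Time is coordinate \<open>0\<close>, so \<open>i \<le> N\<close> counts it together with
  \<open>N\<close> further coordinates; in \<open>\<Psi>\<close> time is quantified away and only
  the coordinates \<open>i < N\<close> are left. Baire alone makes one truth value and threshold
  valid on a dense set; definability of \<open>\<Psi>\<close> upgrades this to an open set.\<close>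

lemma definable_pred_uniform_tail:
  assumes "o_minimal M" "definable_pred M \<Phi>"
    and supp: "\<And>v w. (\<And>i. i \<le> N \<Longrightarrow> v i = w i) \<Longrightarrow> \<Phi> v = \<Phi> w"
  obtains V and n :: nat where "open V" "V \<noteq> {}"
    "(\<forall>v\<in>V. \<forall>t\<ge>real n. \<Phi> (case_nat t v)) \<or> (\<forall>v\<in>V. \<forall>t\<ge>real n. \<not> \<Phi> (case_nat t v))"
proof -
  define X where "X = (\<lambda>(\<sigma>, n::nat). {v. \<forall>t. real n \<le> t \<longrightarrow> \<Phi> (case_nat t v) = \<sigma>})"
  have "v \<in> \<Union>(range X)" for v
  proof -
    obtain F where F: "finite F" "\<forall>J\<in>F. is_interval J" "{a. \<Phi> ((case_nat 0 v)(0 := a))} = \<Union>F"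
      using o_minimal_definable_pred[OF assms(1,2), of "case_nat 0 v" 0] by metis
    have "(case_nat 0 v)(0 := a) = case_nat a v" for a
      by (auto simp: fun_eq_iff split: nat.splits)
    then have "{a. \<Phi> (case_nat a v)} = \<Union>F" using F(3) by simp
    then have "\<exists>\<sigma> n. v \<in> X (\<sigma>, n)"
    proof -
      consider n where "\<forall>t\<ge>real n. \<Phi> (case_nat t v)" | n where "\<forall>t\<ge>real n. \<not> \<Phi> (case_nat t v)"
        using interval_union_eventually[of F] F(1,2) \<open>{a. \<Phi> (case_nat a v)} = \<Union>F\<close>[symmetric]
        by (metis mem_Collect_eq)
      then show ?thesis
        by cases (auto simp: X_def intro: exI[of _ True] exI[of _ False])
    qed
    then show ?thesis by blast
  qed
  then have "UNIV \<subseteq> \<Union>(range X)" by blast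
  moreover have "countable (range X)" by simp
  ultimately obtain C V1 where "C \<in> range X" and V1: "open V1" "V1 \<noteq> {}" "V1 \<subseteq> closure C"
    using Baire_somewhere_dense[of "range X" UNIV] by (metis UNIV_not_empty open_UNIV)
  then obtain \<sigma> n where C: "C = X (\<sigma>, n)" by auto
  define \<Psi> where "\<Psi> = (\<lambda>v. \<forall>t. real n \<le> case_nat t v 0 \<longrightarrow> \<Phi> (case_nat t v) = \<sigma>)"
  have "definable_pred M (\<lambda>v. \<Phi> v = \<sigma>)"
    using assms(2) definable_pred_neg[OF assms(2)] by (cases \<sigma>) auto
  then have "definable_pred M \<Psi>"
    unfolding \<Psi>_def by (intro definable_pred_all[where \<Phi> = "\<lambda>v. real n \<le> v 0 \<longrightarrow> \<Phi> v = \<sigma>"]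
       definable_pred_imp definable_pred_le definable_fun_var definable_fun_const)
  moreover have "\<Psi> v = \<Psi> w" if "\<And>i. i < N \<Longrightarrow> v i = w i" for v w
  proof -
    have "\<Phi> (case_nat a v) = \<Phi> (case_nat a w)" for a
      using that by (intro supp) (auto split: nat.splits)
    then show ?thesis unfolding \<Psi>_def by simp
  qed
  ultimately obtain V2 where V2: "open V2" "V2 \<noteq> {}" "V2 \<subseteq> V1" "(\<forall>v\<in>V2. \<Psi> v) \<or> (\<forall>v\<in>V2. \<not> \<Psi> v)"
    using definable_pred_somewhere_constant[OF assms(1), of \<Psi> N V1] V1 by metis
  have C\<Psi>: "C = Collect \<Psi>" unfolding C X_def \<Psi>_def by auto
  have "V2 \<inter> C \<noteq> {}"
    using V1 V2 open_Int_closure_eq_empty[of V2 C] by blast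
  then have \<Psi>: "\<Psi> v" if "v \<in> V2" for v using V2 that unfolding C\<Psi> by blast
  show thesis
    by (rule that[OF V2(1,2), of n]) (use \<Psi> in \<open>cases \<sigma>; auto simp: \<Psi>_def\<close>)
qed

section \<open>Linear flows on tori\<close>

definition zspan :: "(nat \<Rightarrow> real) \<Rightarrow> nat set \<Rightarrow> real set" where
  "zspan \<theta> J = range (\<lambda>c :: nat \<Rightarrow> int. \<Sum>j\<in>J. of_int (c j) * \<theta> j)"

text \<open>A shear of the generators amounts to the transposed shear of the coefficient
  vector.\<close>

lemma sum_shear:
  fixes c :: "nat \<Rightarrow> int" and \<theta> :: "nat \<Rightarrow> real"
  assumes "finite J" "p \<in> J" "q \<in> J" "p \<noteq> q"
  shows "(\<Sum>j\<in>J. of_int (c j) * (\<theta>(q := \<theta> q + of_int s * \<theta> p)) j) =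
    (\<Sum>j\<in>J. of_int ((c(p := c p + s * c q)) j) * \<theta> j)"
proof -
  have J: "J = insert p (insert q (J - {p, q}))" using assms by blast
  have "(\<Sum>j\<in>J - {p, q}. of_int (c j) * (\<theta>(q := \<theta> q + of_int s * \<theta> p)) j) =
      (\<Sum>j\<in>J - {p, q}. of_int ((c(p := c p + s * c q)) j) * \<theta> j)"
    by (rule sum.cong) auto
  then show ?thesis
    using assms(1,4) by (subst (1 2) J) (simp add: algebra_simps)
qed

lemma zspan_shear:
  assumes "finite J" "p \<in> J" "q \<in> J" "p \<noteq> q"
  shows "zspan (\<theta>(q := \<theta> q + of_int s * \<theta> p)) J = zspan \<theta> J"
proof
  show "zspan (\<theta>(q := \<theta> q + of_int s * \<theta> p)) J \<subseteq> zspan \<theta> J"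
    unfolding zspan_def sum_shear[OF assms] by blast
  show "zspan \<theta> J \<subseteq> zspan (\<theta>(q := \<theta> q + of_int s * \<theta> p)) J"
  proof
    fix x assume "x \<in> zspan \<theta> J"
    then obtain c :: "nat \<Rightarrow> int" where c: "x = (\<Sum>j\<in>J. of_int (c j) * \<theta> j)"
      unfolding zspan_def by blast
    define c' where "c' = c(p := c p - s * c q)"
    have "c'(p := c' p + s * c' q) = c" using assms(4) by (auto simp: c'_def)
    then have "x = (\<Sum>j\<in>J. of_int (c' j) * (\<theta>(q := \<theta> q + of_int s * \<theta> p)) j)"
      unfolding sum_shear[OF assms] c by simp
    then show "x \<in> zspan (\<theta>(q := \<theta> q + of_int s * \<theta> p)) J"
      unfolding zspan_def by blast
  qed
qed

text \<open>Euclid's algorithm on the coefficients of an integer relation.\<close>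

lemma zspan_drop:
  fixes c :: "nat \<Rightarrow> int"
  assumes "finite J" "(\<Sum>j\<in>J. of_int (c j) * \<theta> j) = 0" "p \<in> J" "c p \<noteq> 0"
  shows "\<exists>\<theta>' J'. J' \<subset> J \<and> zspan \<theta>' J' = zspan \<theta> J"
  using assms
proof (induction "\<Sum>j\<in>J. nat \<bar>c j\<bar>" arbitrary: c \<theta> p rule: less_induct)
  case less
  show ?case
  proof (cases "\<exists>q\<in>J. q \<noteq> p \<and> c q \<noteq> 0")
    case True
    then obtain p q where pq: "p \<in> J" "q \<in> J" "p \<noteq> q" "c q \<noteq> 0" "\<bar>c q\<bar> \<le> \<bar>c p\<bar>"
      using less.prems by (metis linear)
    \<comment> \<open>With this sign \<open>c p - s * c q\<close> has absolute value
      \<open>\<bar>c p\<bar> - \<bar>c q\<bar>\<close>, so the total weight of the relation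
      drops.\<close>
    define s where "s = sgn (c p) * sgn (c q)"
    define c' where "c' = c(p := c p - s * c q)"
    define \<theta>' where "\<theta>' = \<theta>(q := \<theta> q + of_int s * \<theta> p)"
    have "\<bar>c' p\<bar> < \<bar>c p\<bar>"
      using pq(4,5) by (auto simp: c'_def s_def sgn_if abs_if split: if_splits)
    then have "(\<Sum>j\<in>J. nat \<bar>c' j\<bar>) < (\<Sum>j\<in>J. nat \<bar>c j\<bar>)"
      using less.prems(1) pq(1)
      by (intro sum_strict_mono_ex1) (auto simp: c'_def intro!: bexI[of _ p])
    moreover have "c'(p := c' p + s * c' q) = c" using pq by (auto simp: c'_def)
    then have "(\<Sum>j\<in>J. of_int (c' j) * \<theta>' j) = 0"
      unfolding \<theta>'_def sum_shear[OF less.prems(1) pq(1-3)] using less.prems(2) by simp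
    moreover have "c' q \<noteq> 0" using pq by (simp add: c'_def)
    ultimately have "\<exists>\<theta>'' J'. J' \<subset> J \<and> zspan \<theta>'' J' = zspan \<theta>' J"
      using less.hyps less.prems(1) pq(2) by blast
    then show ?thesis
      unfolding \<theta>'_def zspan_shear[OF less.prems(1) pq(1-3)] .
  next
    \<comment> \<open>A relation with a single nonzero coefficient forces
      \<open>\<theta> p = 0\<close>, and the generator \<open>p\<close> can be left out.\<close>
    case False
    have split: "(\<Sum>j\<in>J. of_int (e j) * \<theta> j) = of_int (e p) * \<theta> p + (\<Sum>j\<in>J - {p}. of_int (e j) * \<theta> j)"
      for e :: "nat \<Rightarrow> int"
      using less.prems by (simp add: sum.remove)
    have "(\<Sum>j\<in>J - {p}. of_int (c j) * \<theta> j) = 0"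
      using False by (intro sum.neutral) auto
    then have "\<theta> p = 0" using less.prems split[of c] by simp
    then have "zspan \<theta> (J - {p}) = zspan \<theta> J"
      unfolding zspan_def split by simp
    then show ?thesis using less.prems(3) by blast
  qed
qed

text \<open>A generating family of minimal size is independent, because any relation would let
  \<open>zspan_drop\<close> shrink it.\<close>

lemma zspan_basis:
  obtains m :: nat and \<theta> :: "nat \<Rightarrow> real" where
    "zspan \<theta> {..<m} = zspan \<omega> {..<k}"
    "\<And>c :: nat \<Rightarrow> int. (\<Sum>j<m. of_int (c j) * \<theta> j) = 0 \<Longrightarrow> \<forall>j<m. c j = 0"
proof -
  define P where "P = (\<lambda>J. finite J \<and> (\<exists>\<theta>. zspan \<theta> J = zspan \<omega> {..<k}))"
  have "P {..<k}" unfolding P_def by blast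
  then obtain J where J: "P J" "\<And>J'. P J' \<Longrightarrow> card J \<le> card J'"
    using ex_has_least_nat[of P "{..<k}" card] by blast
  then obtain \<theta> where fin: "finite J" and \<theta>: "zspan \<theta> J = zspan \<omega> {..<k}"
    unfolding P_def by blast
  have indep: "\<forall>j\<in>J. c j = 0" if rel: "(\<Sum>j\<in>J. of_int (c j) * \<theta> j) = 0" for c :: "nat \<Rightarrow> int"
  proof (rule ccontr)
    assume "\<not> (\<forall>j\<in>J. c j = 0)"
    then obtain \<theta>' J' where J': "J' \<subset> J" "zspan \<theta>' J' = zspan \<theta> J"
      using zspan_drop[OF fin rel] by blast
    then have "P J'" unfolding P_def using fin \<theta> by (metis finite_subset psubset_imp_subset)
    then show False using J(2) psubset_card_mono[OF fin J'(1)] by fastforce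
  qed
  obtain h where h: "bij_betw h {..<card J} J"
    using ex_bij_betw_nat_finite[OF fin] by (auto simp: atLeast0LessThan)
  define g where "g = inv_into {..<card J} h"
  have g: "g (h i) = i" if "i < card J" for i
    using h that by (simp add: g_def bij_betw_def)
  have reindex: "(\<Sum>j<card J. of_int (c (h j)) * \<theta> (h j)) = (\<Sum>j\<in>J. of_int (c j) * \<theta> j)"
      for c :: "nat \<Rightarrow> int"
    by (rule sum.reindex_bij_betw[OF h])
  have reindex': "(\<Sum>j<card J. of_int (c j) * \<theta> (h j)) = (\<Sum>j\<in>J. of_int (c (g j)) * \<theta> j)"
      for c :: "nat \<Rightarrow> int"
    unfolding reindex[symmetric] by (intro sum.cong) (simp_all add: g)
  have "zspan (\<lambda>j. \<theta> (h j)) {..<card J} = zspan \<theta> J"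
  proof
    show "zspan (\<lambda>j. \<theta> (h j)) {..<card J} \<subseteq> zspan \<theta> J"
      unfolding zspan_def reindex' by (auto intro: range_eqI[of _ _ "\<lambda>j. _ (g j)"])
    show "zspan \<theta> J \<subseteq> zspan (\<lambda>j. \<theta> (h j)) {..<card J}"
      unfolding zspan_def reindex[symmetric] by (auto intro: range_eqI[of _ _ "\<lambda>j. _ (h j)"])
  qed
  moreover have "c j = 0" if "(\<Sum>j<card J. of_int (c j) * \<theta> (h j)) = 0" "j < card J"
      for c :: "nat \<Rightarrow> int" and j
  proof -
    have "\<forall>j\<in>J. c (g j) = 0" using that(1) unfolding reindex' by (rule indep)
    moreover have "h j \<in> J" using h that(2) by (auto simp: bij_betw_def)
    ultimately show ?thesis using g[OF that(2)] by metis
  qed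
  ultimately show thesis using that[of "\<lambda>j. \<theta> (h j)" "card J"] \<theta> by blast
qed

lemma zspan_member:
  assumes "finite J" "i \<in> J"
  shows "\<theta> i \<in> zspan \<theta> J"
proof -
  have "\<theta> i = (\<Sum>j\<in>J. of_int (if j = i then 1 else 0) * \<theta> j)"
    using assms by (simp add: if_distrib[of of_int] if_distrib[of "\<lambda>x. x * _"] cong: if_cong)
  then show ?thesis unfolding zspan_def by (rule range_eqI[of _ _ "\<lambda>j. if j = i then 1 else 0"])
qed

section \<open>Kronecker's theorem with bounded times\<close>

text \<open>The bound \<open>S\<close> is uniform by compactness of the torus, used here in
  elementary form: modulo integers every target is within \<open>\<epsilon> / 2\<close> of one of
  finitely many grid points, and one time is fixed for each of these.\<close>

lemma Kronecker_syndetic: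
  fixes \<theta> :: "nat \<Rightarrow> real"
  assumes indep: "\<And>c :: nat \<Rightarrow> int. (\<Sum>j<m. of_int (c j) * \<theta> j) = 0 \<Longrightarrow> \<forall>j<m. c j = 0"
    and "\<epsilon> > 0"
  shows "\<exists>S\<ge>0. \<forall>\<beta>. \<exists>s\<ge>0. s \<le> S \<and> (\<exists>h :: nat \<Rightarrow> int. \<forall>i<m. \<bar>s * \<theta> i - of_int (h i) - \<beta> i\<bar> < \<epsilon>)"
proof -
  \<comment> \<open>Independence of the set of values does not exclude repetitions, so these are
    excluded by the relation \<open>\<theta> x - \<theta> y = 0\<close>.\<close>
  have inj: "inj_on \<theta> {..<m}"
  proof (rule inj_onI, rule ccontr)
    fix x y assume xy: "x \<in> {..<m}" "y \<in> {..<m}" "\<theta> x = \<theta> y" "x \<noteq> y"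
    define c :: "nat \<Rightarrow> int" where "c = (\<lambda>j. if j = x then 1 else if j = y then - 1 else 0)"
    have "(\<Sum>j<m. of_int (c j) * \<theta> j) = (\<Sum>j\<in>{x, y}. of_int (c j) * \<theta> j)"
      using xy by (intro sum.mono_neutral_right) (auto simp: c_def)
    also have "\<dots> = 0" using xy by (simp add: c_def)
    finally show False using indep[of c] xy by (auto simp: c_def)
  qed
  have mod: "Modules.module (\<lambda>r. (*) (real_of_int r))"
    by unfold_locales (auto simp: algebra_simps)
  have "\<not> module.dependent (\<lambda>r. (*) (real_of_int r)) (\<theta> ` {..<m})"
  proof
    assume "module.dependent (\<lambda>r. (*) (real_of_int r)) (\<theta> ` {..<m})"
    then obtain u v where u: "v \<in> \<theta> ` {..<m}" "u v \<noteq> 0" "(\<Sum>v\<in>\<theta> ` {..<m}. real_of_int (u v) * v) = 0"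
      using Modules.module.dependent_finite[OF mod, of "\<theta> ` {..<m}"] by auto
    have "(\<Sum>j<m. of_int (u (\<theta> j)) * \<theta> j) = 0"
      using u(3) by (simp add: sum.reindex[OF inj] comp_def)
    from indep[OF this] u(1,2) show False by auto
  qed
  then have Kr: "\<exists>t h. \<forall>i<m. \<bar>t * \<theta> i - of_int (h i) - \<alpha> i\<bar> < \<epsilon> / 2" for \<alpha> :: "nat \<Rightarrow> real"
    using Kronecker_thm_1[OF _ inj, of "\<epsilon> / 2" \<alpha>] \<open>\<epsilon> > 0\<close> by (metis half_gt_zero)
  obtain K :: nat where K: "2 / \<epsilon> < real K" using reals_Archimedean2 by blast
  then have "K > 0" using \<open>\<epsilon> > 0\<close> by (cases "K = 0") (auto simp: field_simps)
  have K': "1 / real K < \<epsilon> / 2" using K \<open>\<epsilon> > 0\<close> \<open>K > 0\<close> by (simp add: field_simps)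
  obtain t where t: "\<And>f :: nat \<Rightarrow> nat. \<exists>h. \<forall>i<m. \<bar>t f * \<theta> i - of_int (h i) - real (f i) / real K\<bar> <
      \<epsilon> / 2"
    using Kr[of "\<lambda>i. real (_ i) / real K"] choice[of "\<lambda>f t. \<exists>h. \<forall>i<m. \<bar>t * \<theta> i - of_int (h i) -
      real (f i) / real K\<bar> < \<epsilon> / 2"]
    by blast
  define N where "N = ({..<m} \<rightarrow>\<^sub>E {..<K})"
  have "finite N" unfolding N_def by (intro finite_PiE) auto
  then have "bdd_above ((\<lambda>f. \<bar>t f\<bar>) ` N)" by simp
  then obtain T0 where T0: "\<And>f. f \<in> N \<Longrightarrow> \<bar>t f\<bar> \<le> T0" unfolding bdd_above_def by auto
  define T where "T = max T0 0"
  have T: "\<bar>t f\<bar> \<le> T" if "f \<in> N" for f using T0[OF that] by (simp add: T_def)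
  have "\<exists>s\<ge>0. s \<le> 2 * T \<and> (\<exists>h :: nat \<Rightarrow> int. \<forall>i<m. \<bar>s * \<theta> i - of_int (h i) - \<beta> i\<bar> < \<epsilon>)" for \<beta>
  proof -
    \<comment> \<open>Kronecker's times may be negative. Adding \<open>T\<close> puts them into
      \<open>[0, 2 * T]\<close>, and the target is corrected by \<open>T * \<theta> i\<close> in
      advance.\<close>
    define \<gamma> where "\<gamma> = (\<lambda>i. \<beta> i - T * \<theta> i)"
    define f where "f = (\<lambda>i\<in>{..<m}. nat \<lfloor>frac (\<gamma> i) * K\<rfloor>)"
    have fK: "\<lfloor>frac (\<gamma> i) * K\<rfloor> \<ge> 0" "\<lfloor>frac (\<gamma> i) * K\<rfloor> < K" for i
      using frac_lt_1[of "\<gamma> i"] \<open>K > 0\<close> by (simp_all add: floor_less_iff)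
    then have "f \<in> N" unfolding N_def f_def by (auto simp: nat_less_iff)
    obtain h where h: "\<forall>i<m. \<bar>t f * \<theta> i - of_int (h i) - real (f i) / real K\<bar> < \<epsilon> / 2"
      using t by blast
    have "\<bar>(t f + T) * \<theta> i - of_int (h i - \<lfloor>\<gamma> i\<rfloor>) - \<beta> i\<bar> < \<epsilon>" if "i < m" for i
    proof -
      have "real (f i) = of_int \<lfloor>frac (\<gamma> i) * K\<rfloor>" using fK(1)[of i] that by (simp add: f_def)
      then have "\<bar>real (f i) - frac (\<gamma> i) * K\<bar> \<le> 1"
        by linarith
      then have "\<bar>real (f i) / K - frac (\<gamma> i)\<bar> \<le> 1 / K"
        using \<open>K > 0\<close> by (simp add: field_simps abs_le_iff)
      then have "\<bar>real (f i) / K - frac (\<gamma> i)\<bar> < \<epsilon> / 2" using K' by linarith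
      moreover have "(t f + T) * \<theta> i - of_int (h i - \<lfloor>\<gamma> i\<rfloor>) - \<beta> i =
          (t f * \<theta> i - of_int (h i) - real (f i) / real K) + (real (f i) / K - frac (\<gamma> i))"
        by (simp add: \<gamma>_def frac_def algebra_simps)
      ultimately show ?thesis using h that by (smt (verit) field_sum_of_halves)
    qed
    then show ?thesis using T[OF \<open>f \<in> N\<close>]
      by (intro exI[of _ "t f + T"] conjI exI[of _ "\<lambda>i. h i - \<lfloor>\<gamma> i\<rfloor>"]) (auto simp: abs_le_iff)
  qed
  moreover have "0 \<le> 2 * T" by (simp add: T_def)
  ultimately show ?thesis by blast
qed

text \<open>A rational chart of the circle, because sine and cosine need not be definable.\<close>

definition circle_chart :: "real \<Rightarrow> complex" where
  "circle_chart s = Complex 1 s / Complex 1 (- s)"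

text \<open>Half-angle substitution: \<open>tan (x / 2)\<close> is the slope of
  \<open>cis (x / 2)\<close>, and dividing by the conjugate doubles the angle. Only the point
  \<open>-1\<close> is missed.\<close>

lemma circle_chart_tan:
  assumes "cos (x / 2) \<noteq> 0"
  shows "circle_chart (tan (x / 2)) = cis x"
proof -
  have "Complex 1 (tan (x / 2)) = cis (x / 2) / of_real (cos (x / 2))"
    "Complex 1 (- tan (x / 2)) = cis (- (x / 2)) / of_real (cos (x / 2))"
    using assms by (simp_all add: complex_eq_iff tan_def Re_divide_of_real Im_divide_of_real)
  then have "circle_chart (tan (x / 2)) = cis (x / 2) / cis (- (x / 2))"
    using assms by (simp add: circle_chart_def)
  then show ?thesis by (simp add: cis_divide)
qed

text \<open>Translates openness in the chart into a box of angles, the form in which Kronecker's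
  theorem applies. Coordinates from \<open>m\<close> on are copied from a point of
  \<open>V\<close>.\<close>

lemma circle_chart_open:
  fixes V :: "(nat \<Rightarrow> real) set"
  assumes "open V" "V \<noteq> {}"
  obtains \<phi>0 \<delta> where "\<delta> > 0"
    "\<And>\<phi>. (\<And>i. i < m \<Longrightarrow> \<bar>\<phi> i - \<phi>0 i\<bar> < \<delta>) \<Longrightarrow> \<exists>v\<in>V. \<forall>i<m. circle_chart (v i) = cis (\<phi> i)"
proof -
  obtain v0 where v0: "v0 \<in> V" using assms by blast
  obtain X where X: "v0 \<in> Pi\<^sub>E UNIV X" "\<And>i. open (X i)" "Pi\<^sub>E UNIV X \<subseteq> V"
    using product_topology_open_contains_basis[OF _ v0, of "\<lambda>i. euclidean" UNIV] assms(1)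
    by (auto simp: open_fun_def)
  define \<phi>0 where "\<phi>0 = (\<lambda>i. 2 * arctan (v0 i))"
  have "\<exists>\<delta>>0. \<forall>x. \<bar>x - \<phi>0 i\<bar> < \<delta> \<longrightarrow> cos (x / 2) \<noteq> 0 \<and> tan (x / 2) \<in> X i" for i
  proof -
    have c: "cos (\<phi>0 i / 2) \<noteq> 0" "tan (\<phi>0 i / 2) = v0 i"
      by (simp_all add: \<phi>0_def tan_arctan)
    have "isCont (\<lambda>x. tan (x / 2)) (\<phi>0 i)" "isCont (\<lambda>x :: real. cos (x / 2)) (\<phi>0 i)"
      using c(1) by (auto intro!: continuous_intros)
    then have "((\<lambda>x. tan (x / 2)) \<longlongrightarrow> v0 i) (nhds (\<phi>0 i))"
      "((\<lambda>x. cos (x / 2)) \<longlongrightarrow> cos (\<phi>0 i / 2)) (nhds (\<phi>0 i))"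
      using tendsto_at_iff_tendsto_nhds[of "\<lambda>x. tan (x / 2)" "\<phi>0 i"]
        tendsto_at_iff_tendsto_nhds[of "\<lambda>x. cos (x / 2)" "\<phi>0 i"]
      by (simp_all add: isCont_def c(2))
    moreover have "v0 i \<in> X i" using X(1) by auto
    ultimately have "\<forall>\<^sub>F x in nhds (\<phi>0 i). cos (x / 2) \<in> - {0} \<and> tan (x / 2) \<in> X i"
      using X(2)[of i] c
      by (intro eventually_conj topological_tendstoD) (auto simp: open_Compl)
    then show ?thesis
      unfolding eventually_nhds_metric by (auto simp: dist_real_def)
  qed
  then obtain \<delta> where \<delta>: "\<And>i. \<delta> i > 0"
    "\<And>i x. \<bar>x - \<phi>0 i\<bar> < \<delta> i \<Longrightarrow> cos (x / 2) \<noteq> 0 \<and> tan (x / 2) \<in> X i" by metis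
  \<comment> \<open>The \<open>1\<close> keeps the minimum over a nonempty set when
    \<open>m = 0\<close>.\<close>
  define d where "d = Min (insert 1 (\<delta> ` {..<m}))"
  have "d > 0" unfolding d_def using \<delta>(1) by auto
  have d: "d \<le> \<delta> i" if "i < m" for i unfolding d_def using that by (intro Min_le) auto
  show thesis
  proof (rule that[OF \<open>d > 0\<close>, of \<phi>0])
    fix \<phi> assume \<phi>: "\<And>i. i < m \<Longrightarrow> \<bar>\<phi> i - \<phi>0 i\<bar> < d"
    define v where "v = (\<lambda>i. if i < m then tan (\<phi> i / 2) else v0 i)"
    have *: "cos (\<phi> i / 2) \<noteq> 0 \<and> tan (\<phi> i / 2) \<in> X i" if "i < m" for i
      using \<delta>(2)[of "\<phi> i" i] \<phi>[OF that] d[OF that] by linarith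
    have "v \<in> Pi\<^sub>E UNIV X"
      using X(1) * unfolding v_def by auto
    then have "v \<in> V" using X(3) by blast
    moreover have "\<forall>i<m. circle_chart (v i) = cis (\<phi> i)"
      using * circle_chart_tan by (simp add: v_def)
    ultimately show "\<exists>v\<in>V. \<forall>i<m. circle_chart (v i) = cis (\<phi> i)" by blast
  qed
qed

text \<open>Following the rotation backwards serves two purposes: every angle is reached from
  \<open>V\<close> within time \<open>S\<close>, and the orbit visits \<open>V\<close> in every time
  window of length \<open>S\<close>.\<close>

lemma circle_flow_syndetic:
  fixes \<theta> :: "nat \<Rightarrow> real"
  assumes indep: "\<And>c :: nat \<Rightarrow> int. (\<Sum>j<m. of_int (c j) * \<theta> j) = 0 \<Longrightarrow> \<forall>j<m. c j = 0"
    and "open V" "V \<noteq> {}"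
  shows "\<exists>S\<ge>0. \<forall>\<phi>. \<exists>s\<ge>0. s \<le> S \<and> (\<exists>v\<in>V. \<forall>i<m. circle_chart (v i) = cis (\<phi> i - \<theta> i * s))"
proof -
  obtain \<phi>0 \<delta> where \<delta>: "\<delta> > 0"
    "\<And>\<phi>. (\<And>i. i < m \<Longrightarrow> \<bar>\<phi> i - \<phi>0 i\<bar> < \<delta>) \<Longrightarrow> \<exists>v\<in>V. \<forall>i<m. circle_chart (v i) = cis (\<phi> i)"
    using circle_chart_open[OF assms(2,3)] by metis
  \<comment> \<open>Kronecker's theorem works modulo integers, so angles are measured in full
    turns.\<close>
  have "\<forall>j<m. c j = 0" if "(\<Sum>j<m. of_int (c j) * (\<theta> j / (2 * pi))) = 0" for c :: "nat \<Rightarrow> int"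
    using that indep[of c] by (simp add: sum_divide_distrib[symmetric])
  from Kronecker_syndetic[where m = m and \<theta> = "\<lambda>i. \<theta> i / (2 * pi)", OF this, of "\<delta> / (2 * pi)"]
  obtain S where S: "S \<ge> 0" "\<And>\<beta>. \<exists>s\<ge>0. s \<le> S \<and>
      (\<exists>h :: nat \<Rightarrow> int. \<forall>i<m. \<bar>s * (\<theta> i / (2 * pi)) - of_int (h i) - \<beta> i\<bar> < \<delta> / (2 * pi))"
    using \<delta>(1) by auto
  have "\<exists>s\<ge>0. s \<le> S \<and> (\<exists>v\<in>V. \<forall>i<m. circle_chart (v i) = cis (\<phi> i - \<theta> i * s))" for \<phi>
  proof -
    obtain s and h :: "nat \<Rightarrow> int" where s: "s \<ge> 0" "s \<le> S"
      "\<And>i. i < m \<Longrightarrow> \<bar>s * (\<theta> i / (2 * pi)) - of_int (h i) - (\<phi> i - \<phi>0 i) / (2 * pi)\<bar> < \<delta> / (2 * pi)"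
      using S(2)[of "\<lambda>i. (\<phi> i - \<phi>0 i) / (2 * pi)"] by blast
    \<comment> \<open>The integers \<open>h i\<close> are the full turns that bring the angle close
      to \<open>\<phi>0 i\<close>; they vanish under \<open>cis\<close>.\<close>
    define \<psi> where "\<psi> = (\<lambda>i. \<phi> i - \<theta> i * s + 2 * pi * of_int (h i))"
    have "\<bar>\<psi> i - \<phi>0 i\<bar> < \<delta>" if "i < m" for i
    proof -
      have "\<psi> i - \<phi>0 i = - (2 * pi) * (s * (\<theta> i / (2 * pi)) - of_int (h i) - (\<phi> i - \<phi>0 i) / (2 *
          pi))"
        by (simp add: \<psi>_def field_simps)
      then have "\<bar>\<psi> i - \<phi>0 i\<bar> = (2 * pi) * \<bar>s * (\<theta> i / (2 * pi)) - of_int (h i) - (\<phi> i - \<phi>0 i) /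
          (2 * pi)\<bar>"
        by (simp add: abs_mult)
      also have "\<dots> < 2 * pi * (\<delta> / (2 * pi))"
        using s(3)[OF that] by (intro mult_strict_left_mono) auto
      finally show ?thesis by simp
    qed
    then obtain v where "v \<in> V" "\<forall>i<m. circle_chart (v i) = cis (\<psi> i)" using \<delta>(2) by blast
    moreover have "cis (\<psi> i) = cis (\<phi> i - \<theta> i * s)" for i
      by (simp add: \<psi>_def cis_mult[symmetric] cis_multiple_2pi)
    ultimately show ?thesis using s by auto
  qed
  then show ?thesis using S(1) by blast
qed

section \<open>Monomial parametrisation of the torus\<close>

lemma power_int_sum:
  fixes x :: "'a::field"
  assumes "x \<noteq> 0"
  shows "x powi (\<Sum>j\<in>J. c j) = (\<Prod>j\<in>J. x powi c j)"
  using assms by (induction J rule: infinite_finite_induct) (simp_all add: power_int_add)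

lemma prod_power_int:
  fixes f :: "'b \<Rightarrow> 'a::field"
  shows "(\<Prod>j\<in>J. f j) powi n = (\<Prod>j\<in>J. f j powi n)"
  by (induction J rule: infinite_finite_induct) (simp_all add: power_int_mult_distrib)

text \<open>Frequencies written in the basis and the basis written in frequencies give integer
  matrices \<open>b\<close> and \<open>a\<close>. The product of \<open>b\<close> and
  \<open>a\<close> may differ from the identity, but only by integer relations among
  \<open>ws\<close>, and these are respected by the points of \<open>torus ws\<close>.\<close>

lemma torus_factor:
  obtains m :: nat and \<theta> :: "nat \<Rightarrow> real" and b :: "nat \<Rightarrow> nat \<Rightarrow> int" where
    "\<And>c :: nat \<Rightarrow> int. (\<Sum>j<m. of_int (c j) * \<theta> j) = 0 \<Longrightarrow> \<forall>j<m. c j = 0"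
    "\<And>i. i < length ws \<Longrightarrow> ws ! i = (\<Sum>j<m. of_int (b i j) * \<theta> j)"
    "\<And>\<tau>. \<tau> \<in> torus ws \<Longrightarrow> \<exists>z. (\<forall>j<m. cmod (z j) = 1) \<and> (\<forall>i<length ws. \<tau> ! i = (\<Prod>j<m. z j powi b i j))"
proof -
  let ?k = "length ws"
  obtain m and \<theta> :: "nat \<Rightarrow> real" where span: "zspan \<theta> {..<m} = zspan (\<lambda>i. ws ! i) {..<?k}"
    and indep: "\<And>c :: nat \<Rightarrow> int. (\<Sum>j<m. of_int (c j) * \<theta> j) = 0 \<Longrightarrow> \<forall>j<m. c j = 0"
    using zspan_basis[of "\<lambda>i. ws ! i" ?k] by metis
  have "\<exists>c :: nat \<Rightarrow> int. ws ! i = (\<Sum>j<m. of_int (c j) * \<theta> j)" if "i < ?k" for i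
  proof -
    have "ws ! i \<in> zspan \<theta> {..<m}"
      using zspan_member[of "{..<?k}" i "\<lambda>i. ws ! i"] that unfolding span by simp
    then show ?thesis unfolding zspan_def by blast
  qed
  then obtain b :: "nat \<Rightarrow> nat \<Rightarrow> int" where b: "\<And>i. i < ?k \<Longrightarrow> ws ! i = (\<Sum>j<m. of_int (b i j) * \<theta> j)"
    by metis
  have "\<exists>c :: nat \<Rightarrow> int. \<theta> j = (\<Sum>i<?k. of_int (c i) * ws ! i)" if "j < m" for j
  proof -
    have "\<theta> j \<in> zspan (\<lambda>i. ws ! i) {..<?k}"
      using zspan_member[of "{..<m}" j \<theta>] that unfolding span by simp
    then show ?thesis unfolding zspan_def by blast
  qed
  then obtain a :: "nat \<Rightarrow> nat \<Rightarrow> int" where a: "\<And>j. j < m \<Longrightarrow> \<theta> j = (\<Sum>i<?k. of_int (a j i) * ws ! i)"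
    by metis
  have "\<exists>z. (\<forall>j<m. cmod (z j) = 1) \<and> (\<forall>i<?k. \<tau> ! i = (\<Prod>j<m. z j powi b i j))" if \<tau>: "\<tau> \<in> torus ws"
      for \<tau>
  proof -
    have unit: "cmod (\<tau> ! i) = 1" if "i < ?k" for i using \<tau> that unfolding torus_def by blast
    have nz: "\<tau> ! i \<noteq> 0" if "i < ?k" for i using unit[OF that] by auto
    have rel: "(\<Prod>i<?k. (\<tau> ! i) powi c i) = 1" if "(\<Sum>i<?k. of_int (c i) * ws ! i) = 0"
        for c :: "nat \<Rightarrow> int"
      using \<tau> that unfolding torus_def by blast
    define z where "z = (\<lambda>j. \<Prod>l<?k. (\<tau> ! l) powi a j l)"
    have "cmod (z j) = 1" for j
      unfolding z_def by (simp add: prod_norm[symmetric] norm_power_int unit)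
    moreover have "\<tau> ! i = (\<Prod>j<m. z j powi b i j)" if i: "i < ?k" for i
    proof -
      define c where "c = (\<lambda>l. (\<Sum>j<m. a j l * b i j))"
      have "ws ! i = (\<Sum>j<m. of_int (b i j) * (\<Sum>l<?k. of_int (a j l) * ws ! l))"
        using b[OF i] a by simp
      also have "\<dots> = (\<Sum>l<?k. of_int (c l) * ws ! l)"
        unfolding c_def by (simp add: sum_distrib_left sum_distrib_right algebra_simps) (rule
          sum.swap)
      finally have "(\<Sum>l<?k. of_int (c l - (if l = i then 1 else 0)) * ws ! l) = 0"
        using i by (simp add: algebra_simps sum_subtractf if_distrib[of of_int] if_distrib[of "\<lambda>x.
          _ * x"] cong: if_cong)
      from rel[OF this] have "1 = (\<Prod>l<?k. (\<tau> ! l) powi c l / (\<tau> ! l) powi (if l = i then 1 else 0))"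
        using nz by (simp add: power_int_diff)
      also have "\<dots> = (\<Prod>l<?k. (\<tau> ! l) powi c l) / (\<tau> ! i)"
        using i by (simp add: prod_dividef if_distrib[of "\<lambda>x. _ powi x"] cong: if_cong)
      finally have "\<tau> ! i = (\<Prod>l<?k. (\<tau> ! l) powi c l)"
        using nz[OF i] by (simp add: field_simps)
      also have "\<dots> = (\<Prod>l<?k. \<Prod>j<m. ((\<tau> ! l) powi a j l) powi b i j)"
        unfolding c_def using nz by (intro prod.cong refl) (simp add: power_int_sum power_int_mult)
      also have "\<dots> = (\<Prod>j<m. z j powi b i j)"
        unfolding z_def prod_power_int by (rule prod.swap)
      finally show ?thesis .
    qed
    ultimately show ?thesis by blast
  qed
  then show thesis using that indep b by blast
qed

text \<open>Separates the dynamics from the matrices: of the cone only definability in the chart,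
  the forward rotation rule and the orbit are used.\<close>

lemma equivariant_definable_uniform:
  fixes F :: "(nat \<Rightarrow> complex) \<Rightarrow> real \<Rightarrow> bool" and \<theta> :: "nat \<Rightarrow> real"
  assumes "o_minimal M"
    and def: "definable_pred M (\<lambda>w. F (\<lambda>i. circle_chart (w (Suc i))) (w 0))"
    and indep: "\<And>c :: nat \<Rightarrow> int. (\<Sum>j<m. of_int (c j) * \<theta> j) = 0 \<Longrightarrow> \<forall>j<m. c j = 0"
    and cong: "\<And>z z' t. (\<And>i. i < m \<Longrightarrow> z i = z' i) \<Longrightarrow> F z t = F z' t"
    and step: "\<And>z t s. F z t \<Longrightarrow> s \<ge> 0 \<Longrightarrow> F (\<lambda>i. z i * cis (\<theta> i * s)) (t + s)"
    and orbit: "\<And>t. t \<ge> u \<Longrightarrow> F (\<lambda>i. cis (\<theta> i * t)) t"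
  shows "\<exists>t0\<ge>u. \<forall>z t. (\<forall>i<m. cmod (z i) = 1) \<longrightarrow> t \<ge> t0 \<longrightarrow> F z t"
proof -
  let ?\<Phi> = "\<lambda>w. F (\<lambda>i. circle_chart (w (Suc i))) (w 0)"
  have supp: "?\<Phi> v = ?\<Phi> w" if "\<And>i. i \<le> m \<Longrightarrow> v i = w i" for v w :: "nat \<Rightarrow> real"
  proof -
    have "F (\<lambda>i. circle_chart (v (Suc i))) (v 0) = F (\<lambda>i. circle_chart (w (Suc i))) (v 0)"
      by (rule cong) (simp add: that Suc_leI)
    then show ?thesis by (simp add: that)
  qed
  obtain V and n :: nat where V: "open V" "V \<noteq> {}"
    and "(\<forall>v\<in>V. \<forall>t\<ge>real n. ?\<Phi> (case_nat t v)) \<or> (\<forall>v\<in>V. \<forall>t\<ge>real n. \<not> ?\<Phi> (case_nat t v))"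
    by (rule definable_pred_uniform_tail[OF assms(1) def, of m]) (rule supp, simp, rule that)
  then have tail: "(\<forall>v\<in>V. \<forall>t\<ge>real n. F (\<lambda>i. circle_chart (v i)) t) \<or>
      (\<forall>v\<in>V. \<forall>t\<ge>real n. \<not> F (\<lambda>i. circle_chart (v i)) t)"
    by (simp only: nat.case)
  obtain S where S: "S \<ge> 0"
    "\<And>\<phi>. \<exists>s\<ge>0. s \<le> S \<and> (\<exists>v\<in>V. \<forall>i<m. circle_chart (v i) = cis (\<phi> i - \<theta> i * s))"
    using circle_flow_syndetic[OF indep V] by blast
  have "\<exists>v\<in>V. \<exists>t\<ge>real n. F (\<lambda>i. circle_chart (v i)) t"
  proof -
    \<comment> \<open>For every \<open>s\<close> between \<open>0\<close> and \<open>S\<close> the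
      time \<open>T - s\<close> is past both \<open>n\<close> and \<open>u\<close>, whatever the
      sign of \<open>u\<close>.\<close>
    define T where "T = real n + S + \<bar>u\<bar>"
    obtain s v where s: "s \<ge> 0" "s \<le> S" "v \<in> V" "\<forall>i<m. circle_chart (v i) = cis (\<theta> i * T - \<theta> i * s)"
      using S(2)[of "\<lambda>i. \<theta> i * T"] by blast
    have "T - s \<ge> u" "T - s \<ge> real n" using s unfolding T_def by linarith+
    moreover have "F (\<lambda>i. circle_chart (v i)) (T - s) = F (\<lambda>i. cis (\<theta> i * (T - s))) (T - s)"
      by (rule cong) (use s(4) in \<open>simp add: right_diff_distrib\<close>)
    ultimately show ?thesis using orbit s(3) by blast
  qed
  then have pos: "\<And>v t. v \<in> V \<Longrightarrow> t \<ge> real n \<Longrightarrow> F (\<lambda>i. circle_chart (v i)) t"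
    using tail by blast
  have "F z t" if z: "\<forall>i<m. cmod (z i) = 1" and t: "t \<ge> max u (real n + S)" for z t
  proof -
    \<comment> \<open>Start in \<open>V\<close> at time \<open>t - s\<close>, which is still at
      least \<open>n\<close>, and let the flow arrive at the angle \<open>z\<close> at time
      \<open>t\<close>.\<close>
    obtain s v where s: "s \<ge> 0" "s \<le> S" "v \<in> V" "\<forall>i<m. circle_chart (v i) = cis (Arg (z i) - \<theta> i *
        s)"
      using S(2)[of "\<lambda>i. Arg (z i)"] by blast
    have "F (\<lambda>i. circle_chart (v i)) (t - s)" using pos[OF s(3)] s(2) t by simp
    from step[OF this s(1)] have "F (\<lambda>i. circle_chart (v i) * cis (\<theta> i * s)) t" by simp
    moreover have "circle_chart (v i) * cis (\<theta> i * s) = z i" if "i < m" for i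
    proof -
      have "z i \<noteq> 0" using z that by auto
      then have "cis (Arg (z i)) = z i" using z that by (simp add: cis_Arg sgn_div_norm)
      then show ?thesis using s(4) that by (simp add: cis_mult)
    qed
    ultimately show ?thesis using cong[of "\<lambda>i. circle_chart (v i) * cis (\<theta> i * s)" z t] by blast
  qed
  then show ?thesis by (intro exI[of _ "max u (real n + S)"]) auto
qed

section \<open>Exponentials of Jordan matrices\<close>

lemma diag_block_mat_map_carrier:
  assumes "\<And>x. x \<in> set xs \<Longrightarrow> f x \<in> carrier_mat (n x) (n x)"
  shows "diag_block_mat (map f xs) \<in> carrier_mat (\<Sum>x\<leftarrow>xs. n x) (\<Sum>x\<leftarrow>xs. n x)"
  using assms by (induction xs) (auto simp: Let_def)

lemma diag_block_mat_map_mult: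
  fixes f g :: "'b \<Rightarrow> 'a::comm_ring_1 mat"
  assumes "\<And>x. x \<in> set xs \<Longrightarrow> f x \<in> carrier_mat (n x) (n x)"
    "\<And>x. x \<in> set xs \<Longrightarrow> g x \<in> carrier_mat (n x) (n x)"
  shows "diag_block_mat (map f xs) * diag_block_mat (map g xs) = diag_block_mat (map (\<lambda>x. f x * g
    x) xs)"
  using assms
proof (induction xs)
  case (Cons x xs)
  define N where "N = (\<Sum>x\<leftarrow>xs. n x)"
  have c: "diag_block_mat (map f xs) \<in> carrier_mat N N" "diag_block_mat (map g xs) \<in> carrier_mat N
      N"
    "diag_block_mat (map (\<lambda>x. f x * g x) xs) \<in> carrier_mat N N"
    unfolding N_def
    by (rule diag_block_mat_map_carrier, use mult_carrier_mat[OF Cons.prems] Cons.prems in simp)+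
  have fg: "f x \<in> carrier_mat (n x) (n x)" "g x \<in> carrier_mat (n x) (n x)" using Cons.prems by auto
  have IH: "diag_block_mat (map f xs) * diag_block_mat (map g xs) = diag_block_mat (map (\<lambda>x. f x *
      g x) xs)"
    using Cons by simp
  show ?case
    unfolding list.map diag_block_mat.simps Let_def
    using c fg
    by (subst mult_four_block_mat[of _ "n x" "n x" _ N _ N _ _ "n x" _ N]) (auto simp: IH)
qed simp

text \<open>The quantifier over \<open>f\<close> stands inside: the block and the position in it
  depend on \<open>i\<close>, \<open>j\<close> and the sizes only. So one choice serves all powers
  in a series, and all arguments of a definable family.\<close>

lemma diag_block_mat_entry:
  assumes "i < (\<Sum>x\<leftarrow>xs. n x)" "j < (\<Sum>x\<leftarrow>xs. n x)"
  shows "(\<exists>x\<in>set xs. \<exists>i' j'. i' < n x \<and> j' < n x \<and>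
      (\<forall>f :: 'b \<Rightarrow> 'a::zero mat. (\<forall>x\<in>set xs. f x \<in> carrier_mat (n x) (n x))
        \<longrightarrow> diag_block_mat (map f xs) $$ (i, j) = f x $$ (i', j'))) \<or>
    (\<forall>f :: 'b \<Rightarrow> 'a mat. (\<forall>x\<in>set xs. f x \<in> carrier_mat (n x) (n x))
      \<longrightarrow> diag_block_mat (map f xs) $$ (i, j) = 0)"
  using assms
proof (induction xs arbitrary: i j)
  case (Cons y xs)
  define N where "N = (\<Sum>x\<leftarrow>xs. n x)"
  have ij: "i < n y + N" "j < n y + N" using Cons.prems by (simp_all add: N_def)
  have eq: "diag_block_mat (map f (y # xs)) $$ (i, j) =
      (if i < n y then if j < n y then f y $$ (i, j) else 0
       else if j < n y then 0 else diag_block_mat (map f xs) $$ (i - n y, j - n y))"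
    if f: "\<forall>x\<in>set (y # xs). f x \<in> carrier_mat (n x) (n x)" for f :: "'b \<Rightarrow> 'a mat"
  proof -
    have c: "diag_block_mat (map f xs) \<in> carrier_mat N N"
      unfolding N_def using f by (auto intro!: diag_block_mat_map_carrier)
    have "f y \<in> carrier_mat (n y) (n y)" using f by simp
    then show ?thesis using c ij by (auto simp: Let_def)
  qed
  show ?case
  proof (cases "i < n y"; cases "j < n y")
    assume "i < n y" "j < n y"
    then show ?thesis by (intro disjI1 bexI[of _ y] exI[of _ i] exI[of _ j] conjI allI impI)
        (simp_all add: eq del: diag_block_mat.simps list.map)
  next
    assume "i < n y" "\<not> j < n y"
    then show ?thesis by (intro disjI2 allI impI) (simp_all add: eq del: diag_block_mat.simps
        list.map)
  next
    assume "\<not> i < n y" "j < n y"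
    then show ?thesis by (intro disjI2 allI impI) (simp_all add: eq del: diag_block_mat.simps
        list.map)
  next
    assume ge: "\<not> i < n y" "\<not> j < n y"
    then have "i - n y < N" "j - n y < N" using ij by auto
    from Cons.IH[OF this[unfolded N_def]] show ?thesis
    proof (elim disjE bexE exE conjE)
      fix x i' j'
      assume "x \<in> set xs" "i' < n x" "j' < n x"
        "\<forall>f :: 'b \<Rightarrow> 'a mat. (\<forall>x\<in>set xs. f x \<in> carrier_mat (n x) (n x)) \<longrightarrow>
           diag_block_mat (map f xs) $$ (i - n y, j - n y) = f x $$ (i', j')"
      then show ?thesis using ge
        by (intro disjI1 bexI[of _ x] exI[of _ i'] exI[of _ j'] conjI allI impI)
          (simp_all add: eq del: diag_block_mat.simps list.map)
    next
      assume "\<forall>f :: 'b \<Rightarrow> 'a mat. (\<forall>x\<in>set xs. f x \<in> carrier_mat (n x) (n x)) \<longrightarrow>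
           diag_block_mat (map f xs) $$ (i - n y, j - n y) = 0"
      then show ?thesis using ge by (intro disjI2 allI impI) (simp_all add: eq del:
          diag_block_mat.simps list.map)
    qed
  qed
qed simp

section \<open>Closed forms for Jordan exponentials\<close>

definition jordan_exp :: "nat \<Rightarrow> complex \<Rightarrow> real \<Rightarrow> complex mat" where
  "jordan_exp n a t = Matrix.mat n n (\<lambda>(i, j).
     if i \<le> j then of_real (t ^ (j - i) / fact (j - i)) * exp (a * of_real t) else 0)"

lemma jordan_exp_carrier [simp]: "jordan_exp n a t \<in> carrier_mat n n"
  by (simp add: jordan_exp_def)

lemma jordan_exp_smult: "jordan_exp n a t = exp (a * of_real t) \<cdot>\<^sub>m jordan_exp n 0 t"
  by (auto simp: jordan_exp_def)

text \<open>On the \<open>r\<close>th superdiagonal this is the binomial expansion of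
  \<open>(s + t) ^ r / fact r\<close>.\<close>

lemma jordan_exp_add: "jordan_exp n 0 s * jordan_exp n 0 t = jordan_exp n 0 (s + t)"
proof (rule eq_matI)
  fix i j assume "i < dim_row (jordan_exp n 0 (s + t))" "j < dim_col (jordan_exp n 0 (s + t))"
  then have ij: "i < n" "j < n" by (simp_all add: jordan_exp_def)
  have "(jordan_exp n 0 s * jordan_exp n 0 t) $$ (i, j) =
      (\<Sum>k<n. if i \<le> k \<and> k \<le> j then complex_of_real (s ^ (k - i) / fact (k - i) * (t ^ (j - k) /
        fact (j - k))) else 0)"
    using ij by (auto simp: jordan_exp_def scalar_prod_def atLeast0LessThan intro!: sum.cong)
  also have "\<dots> = of_real (\<Sum>k\<in>{i..j}. s ^ (k - i) / fact (k - i) * (t ^ (j - k) / fact (j - k)))"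
    using ij unfolding of_real_sum by (intro sum.mono_neutral_cong_right) auto
  also have "\<dots> = jordan_exp n 0 (s + t) $$ (i, j)"
  proof (cases "i \<le> j")
    case True
    define r where "r = j - i"
    have "(\<Sum>k\<in>{i..j}. s ^ (k - i) / fact (k - i) * (t ^ (j - k) / fact (j - k))) =
        (\<Sum>l\<le>r. s ^ l / fact l * (t ^ (r - l) / fact (r - l)))"
      by (rule sum.reindex_bij_witness[of _ "\<lambda>l. i + l" "\<lambda>k. k - i"]) (use True in \<open>auto simp:
        r_def\<close>)
    also have "\<dots> = (\<Sum>l\<le>r. of_nat (r choose l) * s ^ l * t ^ (r - l) / fact r)"
      by (intro sum.cong) (auto simp: binomial_fact)
    also have "\<dots> = (s + t) ^ r / fact r"
      by (simp add: binomial_ring sum_divide_distrib)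
    finally show ?thesis using True ij by (simp add: jordan_exp_def r_def)
  qed (use ij in \<open>simp add: jordan_exp_def\<close>)
  finally show "(jordan_exp n 0 s * jordan_exp n 0 t) $$ (i, j) = jordan_exp n 0 (s + t) $$ (i,
      j)" .
qed (simp_all add: jordan_exp_def)

text \<open>The entry of the \<open>k\<close>th power is \<open>(k choose r) * a ^ (k - r)\<close>
  with \<open>r = j - i\<close>. The terms below \<open>r\<close> vanish, and after a shift by
  \<open>r\<close> the exponential series remains.\<close>

lemma jordan_exp_sums:
  assumes "i < n" "j < n"
  shows "(\<lambda>k. of_real t ^ k * (jordan_block n a ^\<^sub>m k) $$ (i, j) / fact k)
    sums jordan_exp n a t $$ (i, j)"
proof (cases "i \<le> j")
  case True
  define r where "r = j - i"
  define f where "f = (\<lambda>k. of_real t ^ k * (jordan_block n a ^\<^sub>m k) $$ (i, j) / fact k)"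
  have f: "f k = of_real t ^ k * (of_nat (k choose r) * a ^ (k - r)) / fact k" for k
    using assms True by (simp add: f_def jordan_block_pow r_def)
  have "f (k + r) = of_real (t ^ r / fact r) * ((a * of_real t) ^ k /\<^sub>R fact k)" for k
    unfolding f by (simp add: binomial_fact power_add power_mult_distrib scaleR_conv_of_real
      field_simps)
  moreover have "(\<lambda>k. (a * of_real t) ^ k /\<^sub>R fact k) sums exp (a * of_real t)"
    by (rule exp_converges)
  ultimately have "(\<lambda>k. f (k + r)) sums (of_real (t ^ r / fact r) * exp (a * of_real t))"
    by (simp only: sums_mult)
  moreover have "f k = 0" if "k < r" for k using that by (simp add: f)
  ultimately have "f sums (of_real (t ^ r / fact r) * exp (a * of_real t))"
    using sums_zero_iff_shift[of r f] by blast
  then show ?thesis using assms True by (simp add: jordan_exp_def f_def r_def)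
next
  case False
  then show ?thesis using assms by (simp add: jordan_exp_def jordan_block_pow)
qed

lemma smult_pow_mat:
  fixes A :: "'a::comm_ring_1 mat"
  assumes "A \<in> carrier_mat n n"
  shows "(c \<cdot>\<^sub>m A) ^\<^sub>m k = c ^ k \<cdot>\<^sub>m A ^\<^sub>m k"
proof (induction k)
  case (Suc k)
  have "A ^\<^sub>m k \<in> carrier_mat n n" using assms by (rule pow_carrier_mat)
  then show ?case
    using Suc assms mult_smult_assoc_mat[of "A ^\<^sub>m k" n n "c \<cdot>\<^sub>m A" n "c ^ k"]
      mult_smult_distrib[of "A ^\<^sub>m k" n n A n c]
    by (auto intro!: eq_matI)
qed (auto intro!: eq_matI)

lemma mat_exp_jordan_block: "mat_exp (of_real t \<cdot>\<^sub>m jordan_block n 0) = jordan_exp n 0 t"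
proof (rule eq_matI)
  fix i j assume "i < dim_row (jordan_exp n 0 t)" "j < dim_col (jordan_exp n 0 t)"
  then have ij: "i < n" "j < n" by (simp_all add: jordan_exp_def)
  have "jordan_block n (0 :: complex) ^\<^sub>m k \<in> carrier_mat n n" for k by simp
  then have "((complex_of_real t \<cdot>\<^sub>m jordan_block n 0) ^\<^sub>m k) $$ (i, j) =
      of_real t ^ k * (jordan_block n 0 ^\<^sub>m k) $$ (i, j)" for k
    using ij smult_pow_mat[of "jordan_block n (0 :: complex)" n "of_real t" k]
    by (simp add: jordan_block_def)
  then show "mat_exp (of_real t \<cdot>\<^sub>m jordan_block n 0) $$ (i, j) = jordan_exp n 0 t $$ (i, j)"
    using ij sums_unique[OF jordan_exp_sums[OF ij, of t 0]] by (simp add: mat_exp_def)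
qed (simp_all add: jordan_exp_def mat_exp_def)

text \<open>A common form for the three factors of the cone and for the flow, closed under
  multiplication: one scalar per block times the exponential of the nilpotent part.\<close>

definition scaled_jordan :: "(nat \<times> complex) list \<Rightarrow> (nat \<Rightarrow> complex) \<Rightarrow> real \<Rightarrow> complex mat" where
  "scaled_jordan bs c t =
     diag_block_mat (map (\<lambda>l. c l \<cdot>\<^sub>m jordan_exp (fst (bs ! l)) 0 t) [0..<length bs])"

lemma sum_list_block_sizes: "(\<Sum>l\<leftarrow>[0..<length bs]. fst (bs ! l)) = sum_list (map fst bs)"
  by (metis (no_types, lifting) map_nth map_map comp_apply map_eq_conv)

lemma scaled_jordan_carrier:
  "scaled_jordan bs c t \<in> carrier_mat (sum_list (map fst bs)) (sum_list (map fst bs))"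
  unfolding scaled_jordan_def sum_list_block_sizes[symmetric]
  by (rule diag_block_mat_map_carrier) simp

lemma scaled_jordan_mult:
  "scaled_jordan bs c s * scaled_jordan bs c' t = scaled_jordan bs (\<lambda>l. c l * c' l) (s + t)"
proof -
  have "(a \<cdot>\<^sub>m jordan_exp n 0 s) * (b \<cdot>\<^sub>m jordan_exp n 0 t) = (a * b) \<cdot>\<^sub>m jordan_exp n 0 (s + t)"
      for a b n
    unfolding jordan_exp_add[symmetric]
    by (subst mult_smult_assoc_mat[of _ n n _ n], simp, simp, subst mult_smult_distrib[of _ n n _
      n])
      (auto intro!: eq_matI)
  then show ?thesis
    unfolding scaled_jordan_def
    by (subst diag_block_mat_map_mult[where n = "\<lambda>l. fst (bs ! l)"]) auto
qed

lemma block_scalars_eq: "block_scalars bs c = scaled_jordan bs c 0"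
proof -
  have "jordan_exp n 0 0 = 1\<^sub>m n" for n
    by (auto simp: jordan_exp_def intro!: eq_matI)
  then show ?thesis by (simp add: block_scalars_def scaled_jordan_def)
qed

lemma Q_mat_eq: "Q_mat bs t = scaled_jordan bs (\<lambda>_. 1) t"
proof -
  have "Q_mat bs t = diag_block_mat (map (\<lambda>l. (\<lambda>(n, _). mat_exp (complex_of_real t \<cdot>\<^sub>m
      jordan_block n 0)) (bs ! l)) [0..<length bs])"
    unfolding Q_mat_def by (subst map_nth[of bs, symmetric]) (simp only: map_map comp_def)
  also have "\<dots> = scaled_jordan bs (\<lambda>_. 1) t"
    by (auto simp: scaled_jordan_def mat_exp_jordan_block case_prod_unfold intro!: arg_cong[of _ _
      diag_block_mat] eq_matI)
  finally show ?thesis .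
qed

lemma cone_factor:
  assumes "P \<in> carrier_mat d d" "P' \<in> carrier_mat d d" "sum_list (map fst bs) = d"
  shows "P * E_mat bs t * block_scalars bs z * Q_mat bs t * P' =
    P * scaled_jordan bs (\<lambda>l. of_real (exp (Re (snd (bs ! l)) * t)) * z l) t * P'"
proof -
  have c: "scaled_jordan bs c t \<in> carrier_mat d d" for c t
    using scaled_jordan_carrier[of bs] unfolding assms(3) .
  have assoc: "P * E * B * Q * P' = P * (E * B * Q) * P'"
    if "E \<in> carrier_mat d d" "B \<in> carrier_mat d d" "Q \<in> carrier_mat d d" for E B Q
    using that assms by (simp add: assoc_mult_mat[of _ d d _ d _ d])
  show ?thesis
    unfolding E_mat_def block_scalars_eq Q_mat_eq assoc[OF c c c] scaled_jordan_mult by simp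
qed

lemma complex_of_real_of_rat: "complex_of_real (real_of_rat q) = of_rat q"
  by (cases q) (simp add: of_rat_rat)

text \<open>Each entry of the conjugated power series is a finite linear combination of entries from
  the Jordan blocks, so convergence is inherited from \<open>jordan_exp_sums\<close>.\<close>

lemma flow_complex:
  fixes A :: "rat mat"
  assumes "A \<in> carrier_mat d d"
    and sim: "similar_mat_wit (map_mat of_rat A) (jordan_matrix bs) P P'"
  shows "map_mat complex_of_real (flow A t) =
    P * scaled_jordan bs (\<lambda>l. exp (snd (bs ! l) * of_real t)) t * P'"
proof -
  let ?Ac = "map_mat of_rat A :: complex mat" and ?Ar = "map_mat real_of_rat A"
  let ?D = "scaled_jordan bs (\<lambda>l. exp (snd (bs ! l) * of_real t)) t"
  have Ac: "?Ac \<in> carrier_mat d d" and Ar: "?Ar \<in> carrier_mat d d" using assms(1) by auto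
  note w = similar_mat_witD2[OF Ac sim]
  have dim: "sum_list (map fst bs) = d" using w(5) by auto
  have D: "?D \<in> carrier_mat d d" using scaled_jordan_carrier[of bs] unfolding dim .
  have Dsums: "(\<lambda>k. of_real t ^ k * (jordan_matrix bs ^\<^sub>m k) $$ (i, j) / fact k) sums ?D $$ (i, j)"
    if "i < d" "j < d" for i j
  proof -
    let ?n = "\<lambda>l. fst (bs ! l)"
    let ?B = "\<lambda>k l. jordan_block (?n l) (snd (bs ! l)) ^\<^sub>m k"
    have Jk: "jordan_matrix bs ^\<^sub>m k = diag_block_mat (map (?B k) [0..<length bs])" for k
      unfolding jordan_matrix_pow by (subst map_nth[of bs, symmetric]) (simp add: comp_def
        case_prod_unfold)
    have Deq: "?D = diag_block_mat (map (\<lambda>l. jordan_exp (?n l) (snd (bs ! l)) t) [0..<length bs])"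
      unfolding scaled_jordan_def by (subst (2) jordan_exp_smult) simp
    have lt: "i < (\<Sum>l\<leftarrow>[0..<length bs]. ?n l)" "j < (\<Sum>l\<leftarrow>[0..<length bs]. ?n l)"
      using that unfolding sum_list_block_sizes dim .
    from diag_block_mat_entry[OF lt] show ?thesis
    proof (elim disjE bexE exE conjE)
      fix l i' j'
      assume "i' < ?n l" "j' < ?n l" and e: "\<forall>f :: nat \<Rightarrow> complex mat. (\<forall>l\<in>set [0..<length bs]. f l
        \<in> carrier_mat (?n l) (?n l)) \<longrightarrow>
           diag_block_mat (map f [0..<length bs]) $$ (i, j) = f l $$ (i', j')"
      then show ?thesis
        unfolding Jk Deq using jordan_exp_sums[of i' "?n l" j' t "snd (bs ! l)"] by simp
    next
      assume e: "\<forall>f :: nat \<Rightarrow> complex mat. (\<forall>l\<in>set [0..<length bs]. f l \<in> carrier_mat (?n l) (?n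
        l)) \<longrightarrow>
           diag_block_mat (map f [0..<length bs]) $$ (i, j) = 0"
      then show ?thesis unfolding Jk Deq by simp
    qed
  qed
  show ?thesis
  proof (rule eq_matI)
    fix i j assume "i < dim_row (P * ?D * P')" "j < dim_col (P * ?D * P')"
    then have ij: "i < d" "j < d" using w by auto
    have triple: "(P * X * P') $$ (i, j) = (\<Sum>b<d. (\<Sum>a<d. P $$ (i, a) * X $$ (a, b)) * P' $$ (b, j))"
      if "X \<in> carrier_mat d d" for X
      using that w(6,7) ij by (simp add: scalar_prod_def atLeast0LessThan del: assoc_mult_mat)
    have Jk: "jordan_matrix bs ^\<^sub>m k \<in> carrier_mat d d" for k using w(5) by simp
    define x where "x = (\<lambda>k. ((t \<cdot>\<^sub>m ?Ar) ^\<^sub>m k) $$ (i, j) / fact k)"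
    have "of_real (x k) = (\<Sum>b<d. (\<Sum>a<d. P $$ (i, a) * (of_real t ^ k * (jordan_matrix bs ^\<^sub>m k) $$
        (a, b) / fact k)) * P' $$ (b, j))" for k
    proof -
      have "map_mat complex_of_real ?Ar = ?Ac"
          by (auto simp: complex_of_real_of_rat intro!: eq_matI)
      then have "map_mat complex_of_real (?Ar ^\<^sub>m k) = ?Ac ^\<^sub>m k"
        using of_real_hom.mat_hom_pow[OF Ar, of k, where ?'a = complex] by (simp only:)
      then have "of_real ((?Ar ^\<^sub>m k) $$ (i, j)) = (?Ac ^\<^sub>m k) $$ (i, j)"
        using ij Ar pow_carrier_mat[OF Ar, of k] by (metis carrier_matD index_map_mat(1))
      also have "\<dots> = (P * jordan_matrix bs ^\<^sub>m k * P') $$ (i, j)"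
        by (simp add: similar_mat_wit_pow_id[OF sim])
      also have "\<dots> = (\<Sum>b<d. (\<Sum>a<d. P $$ (i, a) * (jordan_matrix bs ^\<^sub>m k) $$ (a, b)) * P' $$ (b,
          j))"
        by (rule triple[OF Jk])
      finally have "of_real (x k) = of_real t ^ k / fact k *
          (\<Sum>b<d. (\<Sum>a<d. P $$ (i, a) * (jordan_matrix bs ^\<^sub>m k) $$ (a, b)) * P' $$ (b, j))"
        unfolding x_def smult_pow_mat[OF Ar]
          using ij carrier_matD[OF pow_carrier_mat[OF Ar, of k]] by simp
      then show ?thesis
        by (simp add: sum_distrib_left sum_distrib_right mult_ac)
    qed
    moreover have "(\<lambda>k. \<Sum>b<d. (\<Sum>a<d. P $$ (i, a) * (of_real t ^ k * (jordan_matrix bs ^\<^sub>m k) $$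
        (a, b) / fact k)) * P' $$ (b, j))
        sums (P * ?D * P') $$ (i, j)"
      unfolding triple[OF D] by (intro sums_sum sums_mult2 sums_mult Dsums) auto
    ultimately have sums: "(\<lambda>k. complex_of_real (x k)) sums (P * ?D * P') $$ (i, j)" by simp
    \<comment> \<open>Convergence of the real series is deduced from that of its complex
      image.\<close>
    have "x sums Re ((P * ?D * P') $$ (i, j))" using sums_Re[OF sums] by simp
    moreover have "Im ((P * ?D * P') $$ (i, j)) = 0"
      using sums_Im[OF sums] sums_unique2[OF sums_zero] by simp
    ultimately have "complex_of_real (\<Sum>k. x k) = (P * ?D * P') $$ (i, j)"
      by (simp add: sums_iff complex_eq_iff)
    then show "map_mat complex_of_real (flow A t) $$ (i, j) = (P * ?D * P') $$ (i, j)"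
      using ij Ar unfolding flow_def mat_exp_def x_def by simp
  qed (use w Ar assms(1) in \<open>auto simp: flow_def mat_exp_def\<close>)
qed

section \<open>Definability of the orbit cone\<close>

definition definable_cfun :: "('f, 'r) real_exp_expansion \<Rightarrow> ((nat \<Rightarrow> real) \<Rightarrow> complex) \<Rightarrow> bool" where
  "definable_cfun M g \<longleftrightarrow> definable_fun M (\<lambda>v. Re (g v)) \<and> definable_fun M (\<lambda>v. Im (g v))"

lemma definable_cfun_const: "definable_cfun M (\<lambda>v. c)"
  by (simp add: definable_cfun_def)

lemma definable_cfun_Complex: "definable_fun M g \<Longrightarrow> definable_fun M h
    \<Longrightarrow> definable_cfun M (\<lambda>v. Complex (g v) (h v))"
  by (simp add: definable_cfun_def)

lemma definable_cfun_of_real: "definable_fun M g \<Longrightarrow> definable_cfun M (\<lambda>v. of_real (g v))"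
  by (simp add: definable_cfun_def)

lemma definable_cfun_add: "definable_cfun M g \<Longrightarrow> definable_cfun M h
    \<Longrightarrow> definable_cfun M (\<lambda>v. g v + h v)"
  by (simp add: definable_cfun_def definable_fun_add)

lemma definable_cfun_mult: "definable_cfun M g \<Longrightarrow> definable_cfun M h
    \<Longrightarrow> definable_cfun M (\<lambda>v. g v * h v)"
  by (simp add: definable_cfun_def definable_fun_add definable_fun_diff definable_fun_mult)

lemma definable_cfun_inverse: "definable_cfun M g \<Longrightarrow> definable_cfun M (\<lambda>v. inverse (g v))"
  by (simp add: definable_cfun_def power2_eq_square definable_fun_add definable_fun_divide
    definable_fun_mult definable_fun_uminus)

lemma definable_cfun_power: "definable_cfun M g \<Longrightarrow> definable_cfun M (\<lambda>v. g v ^ n)"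
  by (induction n) (simp_all add: definable_cfun_const definable_cfun_mult)

lemma definable_cfun_power_int: "definable_cfun M g \<Longrightarrow> definable_cfun M (\<lambda>v. g v powi n)"
  by (cases "n \<ge> 0") (simp_all add: power_int_def definable_cfun_power definable_cfun_inverse)

lemma definable_cfun_sum: "(\<And>j. j \<in> J \<Longrightarrow> definable_cfun M (g j))
    \<Longrightarrow> definable_cfun M (\<lambda>v. \<Sum>j\<in>J. g j v)"
  by (induction J rule: infinite_finite_induct) (simp_all add: definable_cfun_const
    definable_cfun_add)

lemma definable_cfun_prod: "(\<And>j. j \<in> J \<Longrightarrow> definable_cfun M (g j))
    \<Longrightarrow> definable_cfun M (\<lambda>v. \<Prod>j\<in>J. g j v)"
  by (induction J rule: infinite_finite_induct) (simp_all add: definable_cfun_const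
    definable_cfun_mult)

lemma definable_cfun_circle_chart: "definable_cfun M (\<lambda>v. circle_chart (v i))"
  unfolding circle_chart_def divide_inverse
  by (intro definable_cfun_mult definable_cfun_inverse definable_cfun_Complex definable_fun_uminus
    definable_fun_const definable_fun_var)

lemma definable_fun_power: "definable_fun M g \<Longrightarrow> definable_fun M (\<lambda>v. g v ^ n)"
  by (induction n) (simp_all add: definable_fun_mult)

definition definable_mat :: "('f, 'r) real_exp_expansion \<Rightarrow> nat \<Rightarrow> ((nat \<Rightarrow> real) \<Rightarrow> complex mat) \<Rightarrow>
    bool" where
  "definable_mat M d X \<longleftrightarrow> (\<forall>v. X v \<in> carrier_mat d d) \<and> (\<forall>i<d. \<forall>j<d. definable_cfun M (\<lambda>v. X v $$
    (i, j)))"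

lemma definable_mat_const: "A \<in> carrier_mat d d \<Longrightarrow> definable_mat M d (\<lambda>v. A)"
  by (simp add: definable_mat_def definable_cfun_const)

lemma definable_mat_mult:
  assumes "definable_mat M d X" "definable_mat M d Y"
  shows "definable_mat M d (\<lambda>v. X v * Y v)"
  unfolding definable_mat_def
proof (intro conjI allI impI)
  show "X v * Y v \<in> carrier_mat d d" for v
    using assms unfolding definable_mat_def by (meson mult_carrier_mat)
  fix i j assume ij: "i < d" "j < d"
  have "(X v * Y v) $$ (i, j) = (\<Sum>k<d. X v $$ (i, k) * Y v $$ (k, j))" for v
  proof -
    have "X v \<in> carrier_mat d d" "Y v \<in> carrier_mat d d" using assms
        by (auto simp: definable_mat_def)
    then show ?thesis using ij by (simp add: scalar_prod_def atLeast0LessThan)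
  qed
  then show "definable_cfun M (\<lambda>v. (X v * Y v) $$ (i, j))"
    by (simp only:) (intro definable_cfun_sum definable_cfun_mult; use assms ij in \<open>simp add:
      definable_mat_def\<close>)
qed

text \<open>The position found by \<open>diag_block_mat_entry\<close> does not depend on
  \<open>v\<close>, so an entry is zero throughout or a scalar \<open>c v l\<close> times a fixed
  multiple of a power of \<open>t v\<close>.\<close>

lemma definable_mat_scaled_jordan:
  assumes "definable_fun M t" "\<And>l. l < length bs \<Longrightarrow> definable_cfun M (\<lambda>v. c v l)" "sum_list (map
      fst bs) = d"
  shows "definable_mat M d (\<lambda>v. scaled_jordan bs (c v) (t v))"
  unfolding definable_mat_def
proof (intro conjI allI impI)
  show "scaled_jordan bs (c v) (t v) \<in> carrier_mat d d" for v
    using scaled_jordan_carrier[of bs] unfolding assms(3) .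
  fix i j assume ij: "i < d" "j < d"
  let ?n = "\<lambda>l. fst (bs ! l)"
  have lt: "i < (\<Sum>l\<leftarrow>[0..<length bs]. ?n l)" "j < (\<Sum>l\<leftarrow>[0..<length bs]. ?n l)"
    using ij unfolding sum_list_block_sizes assms(3) .
  from diag_block_mat_entry[OF lt]
  show "definable_cfun M (\<lambda>v. scaled_jordan bs (c v) (t v) $$ (i, j))"
  proof (elim disjE bexE exE conjE)
    fix l i' j'
    assume l: "l \<in> set [0..<length bs]" "i' < ?n l" "j' < ?n l"
      and e: "\<forall>f :: nat \<Rightarrow> complex mat. (\<forall>l\<in>set [0..<length bs]. f l \<in> carrier_mat (?n l) (?n l)) \<longrightarrow>
         diag_block_mat (map f [0..<length bs]) $$ (i, j) = f l $$ (i', j')"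
    have "scaled_jordan bs (c v) (t v) $$ (i, j) =
        (if i' \<le> j' then c v l * of_real (t v ^ (j' - i') / fact (j' - i')) else 0)" for v
      unfolding scaled_jordan_def
      by (subst e[rule_format]) (use l in \<open>simp_all add: jordan_exp_def\<close>)
    moreover have "definable_cfun M (\<lambda>v. c v l * of_real (t v ^ (j' - i') / fact (j' - i')))"
      using l by (intro definable_cfun_mult definable_cfun_of_real definable_fun_divide
        definable_fun_power definable_fun_const assms) simp
    ultimately show ?thesis by (cases "i' \<le> j'") (simp_all add: definable_cfun_const)
  next
    assume e: "\<forall>f :: nat \<Rightarrow> complex mat. (\<forall>l\<in>set [0..<length bs]. f l \<in> carrier_mat (?n l) (?n l)) \<longrightarrow>
         diag_block_mat (map f [0..<length bs]) $$ (i, j) = 0"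
    have "scaled_jordan bs (c v) (t v) $$ (i, j) = 0" for v
      unfolding scaled_jordan_def by (subst e[rule_format]) simp_all
    then show ?thesis by (simp add: definable_cfun_const)
  qed
qed

lemma definable_pred_real_image:
  assumes "definable M d I" "I \<subseteq> carrier_vec d"
    and "\<And>v. Y v \<in> carrier_vec d" "\<And>i. i < d \<Longrightarrow> definable_cfun M (\<lambda>v. Y v $ i)"
  shows "definable_pred M (\<lambda>v. Y v \<in> map_vec complex_of_real ` I)"
proof -
  \<comment> \<open>\<open>Matrix.vec d\<close> never reads the branch \<open>v (i - d)\<close>; it
    only provides the shape of \<open>definable_pred_subst_block\<close>.\<close>
  have "definable_pred M (\<lambda>v. (\<forall>i<d. Im (Y v $ i) = 0) \<and>
      Matrix.vec d (\<lambda>i. if i < d then Re (Y v $ i) else v (i - d)) \<in> I)"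
    using assms(4) unfolding definable_cfun_def
    by (intro definable_pred_conj definable_pred_Ball_less definable_pred_eq definable_fun_const
        definable_pred_subst_block[OF definable_pred_vec[OF assms(1)], where g = "\<lambda>i v. Re (Y v $
          i)"]) auto
  moreover have "Y v \<in> map_vec complex_of_real ` I \<longleftrightarrow> (\<forall>i<d. Im (Y v $ i) = 0) \<and>
      Matrix.vec d (\<lambda>i. if i < d then Re (Y v $ i) else v (i - d)) \<in> I" for v
  proof
    assume "Y v \<in> map_vec complex_of_real ` I"
    then obtain w where w: "w \<in> I" "Y v = map_vec complex_of_real w" by blast
    then have "w \<in> carrier_vec d" using assms(2) by blast
    then have "Matrix.vec d (\<lambda>i. if i < d then Re (Y v $ i) else v (i - d)) = w"
      unfolding w(2) by (auto intro!: eq_vecI)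
    then show "(\<forall>i<d. Im (Y v $ i) = 0) \<and>
        Matrix.vec d (\<lambda>i. if i < d then Re (Y v $ i) else v (i - d)) \<in> I"
      using w \<open>w \<in> carrier_vec d\<close> by simp
  next
    assume r: "(\<forall>i<d. Im (Y v $ i) = 0) \<and>
        Matrix.vec d (\<lambda>i. if i < d then Re (Y v $ i) else v (i - d)) \<in> I"
    have "Y v = map_vec complex_of_real (Matrix.vec d (\<lambda>i. if i < d then Re (Y v $ i) else v (i -
        d)))"
      using r assms(3)[of v] by (intro eq_vecI) (auto simp: complex_eq_iff)
    then show "Y v \<in> map_vec complex_of_real ` I" using r by blast
  qed
  ultimately show ?thesis by simp
qed

section \<open>The cone inside the invariant\<close>

lemma cis_powi: "cis x powi n = cis (of_int n * x)"
  by (cases n rule: int_cases2) (simp_all add: power_int_def Complex.DeMoivre power_int_minus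
    cis_inverse)

lemma prod_cis: "(\<Prod>j\<in>J. cis (f j)) = cis (\<Sum>j\<in>J. f j)"
  by (induction J rule: infinite_finite_induct) (simp_all add: cis_mult)

lemma scaled_jordan_cong:
  "(\<And>l. l < length bs \<Longrightarrow> c l = c' l) \<Longrightarrow> scaled_jordan bs c t = scaled_jordan bs c' t"
  by (auto simp: scaled_jordan_def intro!: arg_cong[of _ _ diag_block_mat])

theorem theorem7:
  fixes M :: "('f, 'r) real_exp_expansion"
    and d :: nat and A :: "rat mat" and x0 :: "rat vec"
    and bs :: "(nat \<times> complex) list" and P P' :: "complex mat"
    and I :: "real vec set" and s u :: real
  assumes "A \<in> carrier_mat d d" and "x0 \<in> carrier_vec d"
    and "0 \<notin> fst ` set bs"
    and "similar_mat_wit (map_mat of_rat A) (jordan_matrix bs) P P'"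
    and "o_minimal M" and "definable M d I"
    and "invariant_from A x0 s I"
    and "u \<ge> 0" and "orbit_from A x0 u \<subseteq> I"
  shows "\<exists>t0\<ge>u. orbit_cone bs P P' x0 t0 \<subseteq> map_vec complex_of_real ` I"
proof -
  let ?ws = "map (\<lambda>(_, a). Im a) bs"
  let ?J = "map_vec complex_of_real ` I"
  define x :: "complex vec" where "x = map_vec of_rat x0"
  have x: "x \<in> carrier_vec d" using assms(2) by (simp add: x_def)
  have Ac: "(map_mat of_rat A :: complex mat) \<in> carrier_mat d d" using assms(1) by simp
  note w = similar_mat_witD2[OF Ac assms(4)]
  have dim: "sum_list (map fst bs) = d" using w(5) by auto
  have IC: "I \<subseteq> carrier_vec d" using assms(1,7) by (simp add: invariant_from_def)
  \<comment> \<open>\<open>X\<close> describes the flow when \<open>c\<close> comes from the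
    eigenvalues and the cone when it comes from a free angle, so flowing a cone point is the product
    rule \<open>X_mult\<close>.\<close>
  define X where "X = (\<lambda>c t. P * scaled_jordan bs c t * P')"
  have sj: "scaled_jordan bs c t \<in> carrier_mat d d" for c t
    using scaled_jordan_carrier[of bs] unfolding dim .
  have X: "X c t \<in> carrier_mat d d" for c t
    unfolding X_def using w sj by (meson mult_carrier_mat)
  have X_mult: "X c t * X c' t' = X (\<lambda>l. c l * c' l) (t + t')" for c t c' t'
  proof -
    have "X c t * X c' t' = P * scaled_jordan bs c t * (P' * P) * scaled_jordan bs c' t' * P'"
      unfolding X_def using w(6,7) sj
      by (simp add: assoc_mult_mat[of _ d d _ d _ d] mult_carrier_mat[of _ d d _ d])
    then show ?thesis
      unfolding X_def w(2) scaled_jordan_mult[symmetric] using w(6,7) sj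
      by (simp add: assoc_mult_mat[of _ d d _ d _ d] mult_carrier_mat[of _ d d _ d]
          right_mult_one_mat[of _ d d] left_mult_one_mat[of _ d d])
  qed
  have flow: "map_mat complex_of_real (flow A t) = X (\<lambda>l. exp (snd (bs ! l) * of_real t)) t" for t
    unfolding X_def by (rule flow_complex[OF assms(1,4)])
  have flow_c: "flow A t \<in> carrier_mat d d" for t
    using assms(1) by (simp add: flow_def mat_exp_def)
  have hom: "map_vec complex_of_real (flow A t *\<^sub>v v) =
      X (\<lambda>l. exp (snd (bs ! l) * of_real t)) t *\<^sub>v map_vec complex_of_real v"
    if "v \<in> carrier_vec d" for t v
    unfolding flow[symmetric] by (rule of_real_hom.mult_mat_vec_hom[OF flow_c that])
  obtain m and \<theta> :: "nat \<Rightarrow> real" and b :: "nat \<Rightarrow> nat \<Rightarrow> int" where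
    indep: "\<And>c :: nat \<Rightarrow> int. (\<Sum>j<m. of_int (c j) * \<theta> j) = 0 \<Longrightarrow> \<forall>j<m. c j = 0"
    and b: "\<And>i. i < length ?ws \<Longrightarrow> ?ws ! i = (\<Sum>j<m. of_int (b i j) * \<theta> j)"
    and torus: "\<And>\<tau>. \<tau> \<in> torus ?ws \<Longrightarrow>
      \<exists>z. (\<forall>j<m. cmod (z j) = 1) \<and> (\<forall>i<length ?ws. \<tau> ! i = (\<Prod>j<m. z j powi b i j))"
    by (rule torus_factor[of ?ws]) (rule that)
  have Im_b: "Im (snd (bs ! l)) = (\<Sum>j<m. of_int (b l j) * \<theta> j)" if "l < length bs" for l
    using b[of l] that by (simp add: case_prod_unfold)
  have rot: "(\<Prod>j<m. cis (\<theta> j * t) powi b l j) = cis (Im (snd (bs ! l)) * t)" if "l < length bs"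
      for l t
    by (simp add: cis_powi prod_cis Im_b[OF that] sum_distrib_right mult.assoc)
  \<comment> \<open>The true rotation is replaced by a monomial in the free angles; at
    \<open>z j = cis (\<theta> j * t)\<close> the eigenvalue exponential comes back by
    \<open>rot\<close>.\<close>
  define c where "c = (\<lambda>z t l. of_real (exp (Re (snd (bs ! l)) * t)) * (\<Prod>j<m. z j powi b l j) ::
      complex)"
  \<comment> \<open>Membership in the complex image of \<open>I\<close> also says that the point is real, so this needs no
    separate proof.\<close>
  define F where "F = (\<lambda>z t. X (c z t) t *\<^sub>v x \<in> ?J)"
  have def: "definable_pred M (\<lambda>w. F (\<lambda>i. circle_chart (w (Suc i))) (w 0))"
    unfolding F_def
  proof (rule definable_pred_real_image[OF assms(6) IC])
    show "X (c (\<lambda>i. circle_chart (v (Suc i))) (v 0)) (v 0) *\<^sub>v x \<in> carrier_vec d" for v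
      by (rule mult_mat_vec_carrier[OF X x])
    have mat: "definable_mat M d (\<lambda>v. X (c (\<lambda>i. circle_chart (v (Suc i))) (v 0)) (v 0))"
      unfolding X_def c_def
      by (intro definable_mat_mult definable_mat_const definable_mat_scaled_jordan w(6,7) dim
        definable_fun_var definable_cfun_mult
          definable_cfun_of_real definable_fun_exp definable_fun_mult definable_fun_const
            definable_cfun_prod definable_cfun_power_int definable_cfun_circle_chart)
    fix i assume i: "i < d"
    have "(X c' t *\<^sub>v x) $ i = (\<Sum>k<d. X c' t $$ (i, k) * x $ k)" for c' t
      using carrier_matD[OF X[of c' t]] i x by (simp add: scalar_prod_def atLeast0LessThan)
    then show "definable_cfun M (\<lambda>v. (X (c (\<lambda>i. circle_chart (v (Suc i))) (v 0)) (v 0) *\<^sub>v x) $ i)"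
      by (simp only:) (intro definable_cfun_sum definable_cfun_mult definable_cfun_const; use mat
        i in \<open>simp add: definable_mat_def\<close>)
  qed
  have cong: "F z t = F z' t" if "\<And>i. i < m \<Longrightarrow> z i = z' i" for z z' t
  proof -
    have "c z t = c z' t" unfolding c_def using that
        by (intro ext arg_cong2[of _ _ _ _ "(*)"] prod.cong) auto
    then show ?thesis by (simp add: F_def)
  qed
  have step: "F (\<lambda>i. z i * cis (\<theta> i * s)) (t + s)" if F: "F z t" and s: "s \<ge> 0" for z t s
  proof -
    obtain v where v: "v \<in> I" "X (c z t) t *\<^sub>v x = map_vec complex_of_real v"
      using F unfolding F_def by blast
    have "flow A s *\<^sub>v v \<in> I"
      using assms(7) s v(1) unfolding invariant_from_def by blast
    moreover have "map_vec complex_of_real (flow A s *\<^sub>v v) = X (c (\<lambda>i. z i * cis (\<theta> i * s)) (t +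
        s)) (t + s) *\<^sub>v x"
    proof -
      have "v \<in> carrier_vec d" using v(1) IC by blast
      then have "map_vec complex_of_real (flow A s *\<^sub>v v) =
          X (\<lambda>l. exp (snd (bs ! l) * of_real s)) s *\<^sub>v (X (c z t) t *\<^sub>v x)"
        by (simp add: hom v(2))
      also have "\<dots> = X (\<lambda>l. exp (snd (bs ! l) * of_real s) * c z t l) (s + t) *\<^sub>v x"
        unfolding X_mult[symmetric] by (rule assoc_mult_mat_vec[symmetric, OF X X x])
      also have "X (\<lambda>l. exp (snd (bs ! l) * of_real s) * c z t l) (s + t) =
          X (c (\<lambda>i. z i * cis (\<theta> i * s)) (t + s)) (s + t)"
      proof -
        \<comment> \<open>Polar form splits the factor of the flow: its modulus advances the time in
          \<open>c\<close>, and its phase is, by \<open>rot\<close>, the monomial of the rotations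
          \<open>cis (\<theta> i * s)\<close>.\<close>
        have "exp (snd (bs ! l) * of_real s) * c z t l = c (\<lambda>i. z i * cis (\<theta> i * s)) (t + s) l"
          if "l < length bs" for l
        proof -
          have "exp (snd (bs ! l) * of_real s) = of_real (exp (Re (snd (bs ! l)) * s)) * cis (Im
              (snd (bs ! l)) * s)"
            by (simp add: exp_eq_polar)
          then show ?thesis
            by (simp add: c_def power_int_mult_distrib prod.distrib rot[OF that] exp_add
              distrib_left)
        qed
        then show ?thesis unfolding X_def by (simp cong: scaled_jordan_cong)
      qed
      finally show ?thesis by (simp add: add.commute)
    qed
    ultimately show ?thesis unfolding F_def by (metis imageI)
  qed
  have orbit: "F (\<lambda>i. cis (\<theta> i * t)) t" if "t \<ge> u" for t
  proof -
    have "trajectory A x0 t \<in> I" using assms(9) that unfolding orbit_from_def by blast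
    moreover have "map_vec complex_of_real (trajectory A x0 t) = X (c (\<lambda>i. cis (\<theta> i * t)) t) t *\<^sub>v
        x"
    proof -
      have "map_vec complex_of_real (map_vec real_of_rat x0) = x"
        unfolding x_def by (auto simp: complex_of_real_of_rat intro!: eq_vecI)
      then have "map_vec complex_of_real (trajectory A x0 t) = X (\<lambda>l. exp (snd (bs ! l) * of_real
          t)) t *\<^sub>v x"
        unfolding trajectory_def using hom[of "map_vec real_of_rat x0" t] assms(2) by simp
      also have "X (\<lambda>l. exp (snd (bs ! l) * of_real t)) t = X (c (\<lambda>i. cis (\<theta> i * t)) t) t"
      proof -
        have "exp (snd (bs ! l) * of_real t) = c (\<lambda>i. cis (\<theta> i * t)) t l" if "l < length bs" for l
          by (simp add: c_def rot[OF that] exp_eq_polar)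
        then show ?thesis unfolding X_def by (simp cong: scaled_jordan_cong)
      qed
      finally show ?thesis .
    qed
    ultimately show ?thesis unfolding F_def by (metis imageI)
  qed
  have "\<exists>t0\<ge>u. \<forall>z t. (\<forall>i<m. cmod (z i) = 1) \<longrightarrow> t \<ge> t0 \<longrightarrow> F z t"
    by (rule equivariant_definable_uniform[OF assms(5) def indep cong step orbit])
  then obtain t0 where t0: "t0 \<ge> u" "\<And>z t. (\<forall>i<m. cmod (z i) = 1) \<Longrightarrow> t \<ge> t0 \<Longrightarrow> F z t"
    by blast
  have "orbit_cone bs P P' x0 t0 \<subseteq> ?J"
  proof
    fix y assume "y \<in> orbit_cone bs P P' x0 t0"
    then obtain \<tau> t where y: "y = (P * E_mat bs t * block_scalars bs (\<lambda>l. \<tau> ! l) * Q_mat bs t *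
        P') *\<^sub>v x"
      and \<tau>: "\<tau> \<in> torus ?ws" and t: "t \<ge> t0"
      unfolding orbit_cone_def x_def by blast
    obtain z where z: "\<forall>j<m. cmod (z j) = 1" "\<forall>i<length ?ws. \<tau> ! i = (\<Prod>j<m. z j powi b i j)"
      using torus[OF \<tau>] by blast
    have "y = X (c z t) t *\<^sub>v x"
      unfolding y cone_factor[OF w(6,7) dim] X_def c_def using z(2)
        by (simp cong: scaled_jordan_cong)
    then show "y \<in> ?J" using t0(2)[OF z(1) t] unfolding F_def by simp
  qed
  then show ?thesis using t0(1) by blast
qed

end
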